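(* Let $(V,\{M_n(V)^+\},\{|\cdot|_n\})$ be an absolutely matrix ordered space and let $(\mathfrak V,\mathfrak V^+)$, with maps $T_n:M_n(V)\to\mathfrak V$, be the matricial inductive limit of the matrix ordered space $(V,\{M_n(V)^+\})$. For $\mathfrak v\in\mathfrak V$ define $$|\mathfrak v| := T_{o(\mathfrak v)}\big(\,\big|T_{o(\mathfrak v)}^{-1}(\mathfrak v)\big|_{o(\mathfrak v)}\big),$$ and consider the map $|\cdot|:\mathfrak V\to\mathfrak V^+$, $\mathfrak v\mapsto|\mathfrak v|$. Then $(\mathfrak V,\mathfrak V^+,|\cdot|)$ is a non-degenerate absolutely ordered $\mathfrak F$-bimodule.
   Context: **Bimodules.** $\mathfrak F$ is the $*$-algebra of all $\infty\times\infty$ complex matrices with at most finitely many non-zero entries, with conjugate transpose $*$ and operator norm $\|\cdot\|$; $\mathfrak e_{i,j}$ are its matrix units, $\mathfrak I_n=\sum_{i=1}^n\mathfrak e_{i,i}$ and $\mathfrak J_n=\sum_{i=1}^n\mathfrak e_{i,n+i}$. An $\mathfrak F$-bimodule $\mathfrak V$ is non-degenerate if for every $\mathfrak v\in\mathfrak V$ there is $n$ with $\mathfrak I_n\mathfrak v\mathfrak I_n=\mathfrak v$; the least such $n\in\mathbb N$ is the order $o(\mathfrak v)$. It is a complex vector space via $\alpha\mathfrak v=(\alpha\mathfrak I_n)\mathfrak v$ for any such $n$. A $*$-$\mathfrak F$-bimodule has an additive map $*$ with $(\mathfrak a\mathfrak v)^*=\mathfrak v^*\mathfrak a^*$, $(\mathfrak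 v\mathfrak a)^*=\mathfrak a^*\mathfrak v^*$, $\mathfrak v^{**}=\mathfrak v$; $\mathfrak V_{sa}=\{\mathfrak v:\mathfrak v^*=\mathfrak v\}$. An ordered $\mathfrak F$-bimodule $(\mathfrak V,\mathfrak V^+)$ is a $*$-$\mathfrak F$-bimodule with $\mathfrak V^+\subset\mathfrak V_{sa}$ closed under addition and under $\mathfrak v\mapsto\mathfrak a^*\mathfrak v\mathfrak a$ ($\mathfrak a\in\mathfrak F$); $\mathfrak u\le\mathfrak v$ means $\mathfrak v-\mathfrak u\in\mathfrak V^+$. For $\mathfrak v_1,\mathfrak v_2\in\mathfrak V^+$ and $\mathfrak v\in\mathfrak V$, all fixed by $\mathfrak x\mapsto\mathfrak I_n\mathfrak x\mathfrak I_n$, put $(\mathfrak v_1,\mathfrak v_2)_n^+=\mathfrak v_1+\mathfrak J_n^*\mathfrak v_2\mathfrak J_n$ and $sa_n(\mathfrak v)=\mathfrak I_n\mathfrak v\mathfrak J_n+\mathfrak J_n^*\mathfrak v^*\mathfrak I_n$. Elements $\mathfrak u,\mathfrak v\in\mathfrak V$ are $\mathfrak F$-independent if there are disjoint (finite) $I,J\subset\mathbb N$ with $\mathfrak r\mathfrak u\mathfrak r=\mathfrak u$, $\mathfrak s\mathfrak v\mathfrak s=\mathfrak v$, where $\mathfrak r=\sum_{i\in I}\mathfrak e_{i,i}$, $\mathfrak s=\sum_{j\in J}\mathfrak e_{j,j}$. A *non-degenerate absolutely ordered $\mathfrak F$-bimodule* $(\mathfrak V,\mathfrak V^+,|\cdot|)$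 is a non-degenerate ordered $\mathfrak F$-bimodule with a map $|\cdot|:\mathfrak V\to\mathfrak V^+$ such that: (1) $o(|\mathfrak v|)\le o(\mathfrak v)$; (2) $|\mathfrak v|=\mathfrak v$ for $\mathfrak v\in\mathfrak V^+$; (3) $(|\mathfrak v^*|,|\mathfrak v|)^+_{o(\mathfrak v)}+sa_{o(\mathfrak v)}(\mathfrak v)\in\mathfrak V^+$ for all $\mathfrak v$; (4) $|\mathfrak a\mathfrak v\mathfrak b|\le\|\mathfrak a\|\,\big||\mathfrak v|\mathfrak b\big|$ for $\mathfrak v\in\mathfrak V$, $\mathfrak a,\mathfrak b\in\mathfrak F$; (5) $|\mathfrak u+\mathfrak v|=|\mathfrak u|+|\mathfrak v|$ for $\mathfrak F$-independent $\mathfrak u,\mathfrak v$; (6) for $\mathfrak u,\mathfrak v,\mathfrak w\in\mathfrak V^+$ with $|\mathfrak u-\mathfrak v|=\mathfrak u+\mathfrak v$ and $0\le\mathfrak w\le\mathfrak v$: $|\mathfrak u-\mathfrak w|=\mathfrak u+\mathfrak w$; (7) for $\mathfrak u,\mathfrak v,\mathfrak w\in\mathfrak V^+$ with $|\mathfrak u-\mathfrak v|=\mathfrak u+\mathfrak v$ and $|\mathfrak u-\mathfrak w|=\mathfrak u+\mathfrak w$: $\big|\mathfrak u-|\mathfrak v\pm\mathfrak w|\big|=\mathfrak u+|\mathfrak v\pm\mathfrak w|$. **Matrix ordered spaces.** $M_{m,n}(V)$ denotes $m\times n$ matrices over $V$, $M_{m,n}=M_{m,n}(\mathbb C)$, $v\oplus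 w$ is the block diagonal matrix. A matrix ordered space is a complex vector space $V$ with involution (with $[v_{ij}]^*=[v_{ji}^*]$ on matrices) and cones $M_n(V)^+\subset M_n(V)_{sa}$ such that each $(M_n(V)_{sa},M_n(V)^+)$ is a real ordered vector space and $a^*va\in M_m(V)^+$ for $v\in M_n(V)^+$, $a\in M_{n,m}$. An absolutely ordered space $(X,X^+,|\cdot|)$ is a real ordered vector space with $|\cdot|:X\to X^+$ such that: $|v|=v$ for $v\in X^+$; $|v|\pm v\in X^+$; $|kv|=|k||v|$ for $k\in\mathbb R$; if $|u-v|=u+v$ and $0\le w\le v$ then $|u-w|=u+w$; if $|u-v|=u+v$ and $|u-w|=u+w$ then $\big|u-|v\pm w|\big|=u+|v\pm w|$. An absolutely matrix ordered space is a matrix ordered space with maps $|\cdot|_{m,n}:M_{m,n}(V)\to M_n(V)^+$ ($|\cdot|_n:=|\cdot|_{n,n}$) such that: (1) each $(M_n(V)_{sa},M_n(V)^+,|\cdot|_n)$ is an absolutely ordered space; (2) $|\alpha v\beta|_{r,s}\le\|\alpha\|\,\big||v|_{m,n}\beta\big|_{n,s}$ for $v\in M_{m,n}(V)$, $\alpha\in M_{r,m}$, $\beta\in M_{n,s}$; (3) $|v\oplus w|_{m+r,n+s}=|v|_{m,n}\oplus|w|_{r,s}$. The notation $(V,\{M_n(V)^+\},\{|\cdot|_n\})$ displays only the square maps, which determine the rectangular ones. **Matricial inductive limit.** $\mathfrak V$ is the direct limit of the maps $M_n(V)\to M_{n+m}(V)$, $v\mapsto v\oplus 0_m$; i.e.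 $\infty\times\infty$ matrices over $V$ with finitely many non-zero entries, with the obvious $\mathfrak F$-bimodule structure and involution; $T_n:M_n(V)\to\mathfrak V$ is the injective canonical map $v\mapsto v\oplus 0$, with $T_n(M_n(V))=\mathfrak I_n\mathfrak V\mathfrak I_n$, and $\mathfrak V^+=\bigcup_nT_n(M_n(V)^+)$. This is a non-degenerate ordered $\mathfrak F$-bimodule. *)

theory Defs
  imports
    "HOL-Analysis.L2_Norm"
    "Jordan_Normal_Form.VS_Connect"
    "Jordan_Normal_Form.Schur_Decomposition"
begin

section \<open>Infinite matrices with finitely many non-zero entries\<close>

text \<open>Rows and columns are numbered from 0. The algebra over which the bimodules below are
  taken is \<open>complex fmat\<close>.\<close>

typedef (overloaded) 'a fmat =
  "{f :: nat \<Rightarrow> nat \<Rightarrow> 'a::zero. finite {(i, j). f i j \<noteq> 0}}"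
  morphisms entry Abs_fmat
  by (rule exI[of _ "\<lambda>_ _. 0"]) simp

setup_lifting type_definition_fmat

lemma fmat_eqI: "(\<And>i j. entry A i j = entry B i j) \<Longrightarrow> A = B"
  by transfer auto

instantiation fmat :: (zero) zero
begin
lift_definition zero_fmat :: "'a fmat" is "\<lambda>_ _. 0" by simp
instance ..
end

instantiation fmat :: (ab_group_add) ab_group_add
begin

lift_definition plus_fmat :: "'a fmat \<Rightarrow> 'a fmat \<Rightarrow> 'a fmat"
  is "\<lambda>A B i j. A i j + B i j"
  subgoal for A B
    by (rule finite_subset[of _ "{(i, j). A i j \<noteq> 0} \<union> {(i, j). B i j \<noteq> 0}"]) auto
  done

lift_definition minus_fmat :: "'a fmat \<Rightarrow> 'a fmat \<Rightarrow> 'a fmat"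
  is "\<lambda>A B i j. A i j - B i j"
  subgoal for A B
    by (rule finite_subset[of _ "{(i, j). A i j \<noteq> 0} \<union> {(i, j). B i j \<noteq> 0}"]) auto
  done

lift_definition uminus_fmat :: "'a fmat \<Rightarrow> 'a fmat" is "\<lambda>A i j. - A i j" by simp

instance
  by standard (transfer; simp add: fun_eq_iff algebra_simps)+

end

text \<open>The matrix product with respect to a product \<open>f\<close> of the entries. The range of summation
  makes the support finite for every \<open>f\<close>; for \<open>f\<close> with \<open>f 0 b = 0 = f a 0\<close> the sum is the usual
  one over all \<open>k\<close>.\<close>

lift_definition fprod ::
  "('a::zero \<Rightarrow> 'b::zero \<Rightarrow> 'c::comm_monoid_add) \<Rightarrow> 'a fmat \<Rightarrow> 'b fmat \<Rightarrow> 'c fmat"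
  is "\<lambda>f A B i j. \<Sum>k | A i k \<noteq> 0 \<and> B k j \<noteq> 0. f (A i k) (B k j)"
proof -
  fix f :: "'a \<Rightarrow> 'b \<Rightarrow> 'c" and A :: "nat \<Rightarrow> nat \<Rightarrow> 'a" and B :: "nat \<Rightarrow> nat \<Rightarrow> 'b"
  assume A: "finite {(i, j). A i j \<noteq> 0}" and B: "finite {(i, j). B i j \<noteq> 0}"
  have "(i, j) \<in> fst ` {(i, j). A i j \<noteq> 0} \<times> snd ` {(i, j). B i j \<noteq> 0}"
    if "(\<Sum>k | A i k \<noteq> 0 \<and> B k j \<noteq> 0. f (A i k) (B k j)) \<noteq> 0" for i j
  proof -
    from that obtain k where "A i k \<noteq> 0" "B k j \<noteq> 0"
      using sum.not_neutral_contains_not_neutral by blast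
    then show ?thesis by force
  qed
  then have "{(i, j). (\<Sum>k | A i k \<noteq> 0 \<and> B k j \<noteq> 0. f (A i k) (B k j)) \<noteq> 0}
      \<subseteq> fst ` {(i, j). A i j \<noteq> 0} \<times> snd ` {(i, j). B i j \<noteq> 0}"
    by blast
  then show "finite {(i, j). (\<Sum>k | A i k \<noteq> 0 \<and> B k j \<noteq> 0. f (A i k) (B k j)) \<noteq> 0}"
    using A B finite_subset by blast
qed

lemma finite_row_support: "finite {k. entry A i k \<noteq> 0}"
proof -
  have "{k. entry A i k \<noteq> 0} \<subseteq> snd ` {(i, j). entry A i j \<noteq> 0}" by force
  then show ?thesis using entry[of A] by (auto intro: finite_subset)
qed

lemma entry_fprod:
  assumes "finite K" "{k. entry A i k \<noteq> 0 \<and> entry B k j \<noteq> 0} \<subseteq> K"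
    and "\<And>b. f 0 b = 0" "\<And>a. f a 0 = 0"
  shows "entry (fprod f A B) i j = (\<Sum>k\<in>K. f (entry A i k) (entry B k j))"
  unfolding fprod.rep_eq using assms by (intro sum.mono_neutral_left) auto

instantiation fmat :: (ring) ring
begin

definition times_fmat :: "'a fmat \<Rightarrow> 'a fmat \<Rightarrow> 'a fmat" where
  "times_fmat = fprod (*)"

instance
proof
  fix A B C :: "'a fmat"
  have e: "entry (X * Y) i j = (\<Sum>k\<in>K. entry X i k * entry Y k j)"
    if "finite K" "{k. entry X i k \<noteq> 0 \<and> entry Y k j \<noteq> 0} \<subseteq> K" for X Y :: "'a fmat" and i j K
    unfolding times_fmat_def using that by (intro entry_fprod) auto
  show "A * B * C = A * (B * C)"
  proof (rule fmat_eqI)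
    fix i j
    define K where "K = {k. entry A i k \<noteq> 0}"
    define L where "L = (\<Union>k\<in>K. {l. entry B k l \<noteq> 0})"
    have K: "finite K" and L: "finite L"
      unfolding K_def L_def by (auto intro: finite_row_support)
    have AB: "entry (A * B) i l = (\<Sum>k\<in>K. entry A i k * entry B k l)" for l
      using K by (intro e) (auto simp: K_def)
    have supp: "l \<in> L" if "entry (A * B) i l \<noteq> 0" for l
    proof -
      from that obtain k where "k \<in> K" "entry A i k * entry B k l \<noteq> 0"
        unfolding AB by (meson sum.not_neutral_contains_not_neutral)
      then have "entry B k l \<noteq> 0" by auto
      with \<open>k \<in> K\<close> show ?thesis unfolding L_def by blast
    qed
    have "entry (A * B * C) i j = (\<Sum>l\<in>L. (\<Sum>k\<in>K. entry A i k * entry B k l) * entry C l j)"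
      using L supp by (subst e[of L]) (blast, blast, simp only: AB)
    also have "\<dots> = (\<Sum>k\<in>K. \<Sum>l\<in>L. entry A i k * (entry B k l * entry C l j))"
      unfolding sum_distrib_right mult.assoc by (rule sum.swap)
    also have "\<dots> = (\<Sum>k\<in>K. entry A i k * entry (B * C) k j)"
    proof (rule sum.cong[OF refl])
      fix k assume "k \<in> K"
      then have "entry (B * C) k j = (\<Sum>l\<in>L. entry B k l * entry C l j)"
        using L by (intro e) (auto simp: L_def)
      then show "(\<Sum>l\<in>L. entry A i k * (entry B k l * entry C l j)) = entry A i k * entry (B * C) k j"
        by (simp only: sum_distrib_left)
    qed
    also have "\<dots> = entry (A * (B * C)) i j"
      by (rule e[symmetric]) (use K in \<open>auto simp: K_def\<close>)
    finally show "entry (A * B * C) i j = entry (A * (B * C)) i j" .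
  qed
  show "(A + B) * C = A * C + B * C"
  proof (rule fmat_eqI)
    fix i j
    define K where "K = {k. entry A i k \<noteq> 0} \<union> {k. entry B i k \<noteq> 0}"
    have K: "finite K" unfolding K_def by (auto intro: finite_row_support)
    have "entry (X * C) i j = (\<Sum>k\<in>K. entry X i k * entry C k j)" if "X \<in> {A, B, A + B}" for X
      by (rule e[OF K]) (use that in \<open>auto simp: K_def plus_fmat.rep_eq\<close>)
    then show "entry ((A + B) * C) i j = entry (A * C + B * C) i j"
      by (simp add: plus_fmat.rep_eq sum.distrib distrib_right)
  qed
  show "A * (B + C) = A * B + A * C"
  proof (rule fmat_eqI)
    fix i j
    define K where "K = {k. entry A i k \<noteq> 0}"
    have K: "finite K" unfolding K_def by (rule finite_row_support)
    have "entry (A * X) i j = (\<Sum>k\<in>K. entry A i k * entry X k j)" for X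
      by (rule e[OF K]) (auto simp: K_def)
    then show "entry (A * (B + C)) i j = entry (A * B + A * C) i j"
      by (simp add: plus_fmat.rep_eq sum.distrib distrib_left)
  qed
qed

end

text \<open>The adjoint with respect to an involution \<open>s\<close> of the entries. The case distinction, redundant
  if \<open>s 0 = 0\<close>, makes the support finite for every \<open>s\<close>.\<close>

lift_definition fstar :: "('a::zero \<Rightarrow> 'a) \<Rightarrow> 'a fmat \<Rightarrow> 'a fmat"
  is "\<lambda>s A i j. if A j i = 0 then 0 else s (A j i)"
  subgoal for s A
    by (rule finite_subset[OF _ finite_imageI[of "{(i, j). A i j \<noteq> 0}" prod.swap]]) force
  done

abbreviation fadjoint :: "complex fmat \<Rightarrow> complex fmat" where
  "fadjoint \<equiv> fstar cnj"

lift_definition fsmult :: "complex \<Rightarrow> complex fmat \<Rightarrow> complex fmat"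
  is "\<lambda>c A i j. c * A i j"
  subgoal for c A by (rule finite_subset[of _ "{(i, j). A i j \<noteq> 0}"]) auto
  done

lift_definition funit :: "nat \<Rightarrow> nat \<Rightarrow> complex fmat"
  is "\<lambda>p q i j. if i = p \<and> j = q then 1 else 0"
  subgoal for p q by (rule finite_subset[of _ "{(p, q)}"]) auto
  done

definition fdiag :: "nat set \<Rightarrow> complex fmat" where
  "fdiag S = (\<Sum>i\<in>S. funit i i)"

definition fI :: "nat \<Rightarrow> complex fmat" where
  "fI n = (\<Sum>i<n. funit i i)"

definition fJ :: "nat \<Rightarrow> complex fmat" where
  "fJ n = (\<Sum>i<n. funit i (n + i))"

text \<open>The operator norm on \<open>\<ell>\<^sup>2\<close>. All sums over \<open>i\<close> and \<open>k\<close> of matrix entries are finite.\<close>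

definition fnorm :: "complex fmat \<Rightarrow> real" where
  "fnorm A =
    (SUP x \<in> {x :: nat \<Rightarrow> complex.
        summable (\<lambda>k. (cmod (x k))\<^sup>2) \<and> (\<Sum>k. (cmod (x k))\<^sup>2) \<le> 1}.
      sqrt (\<Sum>i. (cmod (\<Sum>k. entry A i k * x k))\<^sup>2))"


section \<open>Bimodules over the finite matrices\<close>

text \<open>The minimum is taken over the positive integers, so the zero vector has order 1.\<close>

definition bimod_order ::
  "(complex fmat \<Rightarrow> 'w \<Rightarrow> 'w) \<Rightarrow> ('w \<Rightarrow> complex fmat \<Rightarrow> 'w) \<Rightarrow> 'w \<Rightarrow> nat" where
  "bimod_order lact ract v = (LEAST n. 1 \<le> n \<and> ract (lact (fI n) v) (fI n) = v)"

text \<open>The axiom \<open>scalars\<close> is part of the usual notion of a bimodule over a complex algebra: the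
  scalars act in the same way from both sides. It does not follow from the other axioms, which
  only concern the ring structure of the algebra.\<close>

locale F_bimodule =
  fixes lact :: "complex fmat \<Rightarrow> 'w::ab_group_add \<Rightarrow> 'w"  (infixr \<open>\<triangleright>\<close> 75)
    and ract :: "'w \<Rightarrow> complex fmat \<Rightarrow> 'w"  (infixl \<open>\<triangleleft>\<close> 74)
  assumes lact_add_left: "(a + b) \<triangleright> v = (a \<triangleright> v) + (b \<triangleright> v)"
    and lact_add_right: "a \<triangleright> (u + v) = (a \<triangleright> u) + (a \<triangleright> v)"
    and lact_assoc: "(a * b) \<triangleright> v = a \<triangleright> (b \<triangleright> v)"
    and ract_add_left: "(u + v) \<triangleleft> a = (u \<triangleleft> a) + (v \<triangleleft> a)"
    and ract_add_right: "v \<triangleleft> (a + b) = (v \<triangleleft> a) + (v \<triangleleft> b)"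
    and ract_assoc: "v \<triangleleft> (a * b) = (v \<triangleleft> a) \<triangleleft> b"
    and lact_ract: "(a \<triangleright> v) \<triangleleft> b = a \<triangleright> (v \<triangleleft> b)"
    and scalars: "(fsmult c a \<triangleright> v) \<triangleleft> b = (a \<triangleright> v) \<triangleleft> fsmult c b"
begin

abbreviation ord :: "'w \<Rightarrow> nat" where
  "ord \<equiv> bimod_order lact ract"

definition scal :: "complex \<Rightarrow> 'w \<Rightarrow> 'w" where
  "scal c v = fsmult c (fI (ord v)) \<triangleright> v"

definition F_independent :: "'w \<Rightarrow> 'w \<Rightarrow> bool" where
  "F_independent u v \<longleftrightarrow> (\<exists>I J. finite I \<and> finite J \<and> I \<inter> J = {} \<and>
     fdiag I \<triangleright> u \<triangleleft> fdiag I = u \<and> fdiag J \<triangleright> v \<triangleleft> fdiag J = v)"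

end

locale star_F_bimodule = F_bimodule lact ract
  for lact :: "complex fmat \<Rightarrow> 'w::ab_group_add \<Rightarrow> 'w"  (infixr \<open>\<triangleright>\<close> 75)
    and ract :: "'w \<Rightarrow> complex fmat \<Rightarrow> 'w"  (infixl \<open>\<triangleleft>\<close> 74) +
  fixes star :: "'w \<Rightarrow> 'w"
  assumes star_add: "star (u + v) = star u + star v"
    and star_lact: "star (a \<triangleright> v) = star v \<triangleleft> fadjoint a"
    and star_ract: "star (v \<triangleleft> a) = fadjoint a \<triangleright> star v"
    and star_star: "star (star v) = v"
begin

definition pair_plus :: "nat \<Rightarrow> 'w \<Rightarrow> 'w \<Rightarrow> 'w" where
  "pair_plus n v1 v2 = v1 + (fadjoint (fJ n) \<triangleright> v2 \<triangleleft> fJ n)"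

definition sa :: "nat \<Rightarrow> 'w \<Rightarrow> 'w" where
  "sa n v = (fI n \<triangleright> v \<triangleleft> fJ n) + (fadjoint (fJ n) \<triangleright> star v \<triangleleft> fI n)"

end

locale ordered_F_bimodule = star_F_bimodule lact ract star
  for lact :: "complex fmat \<Rightarrow> 'w::ab_group_add \<Rightarrow> 'w"  (infixr \<open>\<triangleright>\<close> 75)
    and ract :: "'w \<Rightarrow> complex fmat \<Rightarrow> 'w"  (infixl \<open>\<triangleleft>\<close> 74)
    and star :: "'w \<Rightarrow> 'w" +
  fixes pos :: "'w set"
  assumes pos_sa: "v \<in> pos \<Longrightarrow> star v = v"
    and pos_add: "u \<in> pos \<Longrightarrow> v \<in> pos \<Longrightarrow> u + v \<in> pos"
    and pos_conj: "v \<in> pos \<Longrightarrow> fadjoint a \<triangleright> v \<triangleleft> a \<in> pos"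
begin

abbreviation le :: "'w \<Rightarrow> 'w \<Rightarrow> bool"  (infix \<open>\<preceq>\<close> 50) where
  "u \<preceq> v \<equiv> v - u \<in> pos"

end

locale nondegenerate_absolutely_ordered_F_bimodule = ordered_F_bimodule lact ract star pos
  for lact :: "complex fmat \<Rightarrow> 'w::ab_group_add \<Rightarrow> 'w"  (infixr \<open>\<triangleright>\<close> 75)
    and ract :: "'w \<Rightarrow> complex fmat \<Rightarrow> 'w"  (infixl \<open>\<triangleleft>\<close> 74)
    and star :: "'w \<Rightarrow> 'w"
    and pos :: "'w set" +
  fixes md :: "'w \<Rightarrow> 'w"
  assumes nondegenerate: "\<exists>n\<ge>1. fI n \<triangleright> v \<triangleleft> fI n = v"
    and md_pos: "md v \<in> pos"
    and ord_md: "ord (md v) \<le> ord v"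
    and md_of_pos: "v \<in> pos \<Longrightarrow> md v = v"
    and md_sa: "pair_plus (ord v) (md (star v)) (md v) + sa (ord v) v \<in> pos"
    and md_mult: "md (a \<triangleright> v \<triangleleft> b) \<preceq> scal (of_real (fnorm a)) (md (md v \<triangleleft> b))"
    and md_add: "F_independent u v \<Longrightarrow> md (u + v) = md u + md v"
    and md_orth_le: "u \<in> pos \<Longrightarrow> v \<in> pos \<Longrightarrow> w \<in> pos \<Longrightarrow> md (u - v) = u + v \<Longrightarrow>
      0 \<preceq> w \<Longrightarrow> w \<preceq> v \<Longrightarrow> md (u - w) = u + w"
    and md_orth_md_add: "u \<in> pos \<Longrightarrow> v \<in> pos \<Longrightarrow> w \<in> pos \<Longrightarrow>
      md (u - v) = u + v \<Longrightarrow> md (u - w) = u + w \<Longrightarrow>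
      md (u - md (v + w)) = u + md (v + w)"
    and md_orth_md_diff: "u \<in> pos \<Longrightarrow> v \<in> pos \<Longrightarrow> w \<in> pos \<Longrightarrow>
      md (u - v) = u + v \<Longrightarrow> md (u - w) = u + w \<Longrightarrow>
      md (u - md (v - w)) = u + md (v - w)"


section \<open>Absolutely ordered spaces\<close>

text \<open>A real vector space is a module record over the ring \<open>class_ring\<close> of reals. The cone of a
  real ordered vector space is not required to be proper; in an absolutely ordered space it is.\<close>

locale real_ordered_space = Module.module "class_ring :: real ring" X
  for X :: "(real, 'x) Module.module" (structure) +
  fixes P :: "'x set"
  assumes P_subset: "P \<subseteq> carrier X"
    and P_nonempty: "P \<noteq> {}"
    and P_add: "u \<in> P \<Longrightarrow> v \<in> P \<Longrightarrow> u \<oplus> v \<in> P"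
    and P_smult: "0 \<le> k \<Longrightarrow> v \<in> P \<Longrightarrow> k \<odot> v \<in> P"

locale absolutely_ordered_space = real_ordered_space X P
  for X :: "(real, 'x) Module.module" (structure) and P :: "'x set" +
  fixes md :: "'x \<Rightarrow> 'x"
  assumes md_in: "v \<in> carrier X \<Longrightarrow> md v \<in> P"
    and md_of_pos: "v \<in> P \<Longrightarrow> md v = v"
    and md_plus: "v \<in> carrier X \<Longrightarrow> md v \<oplus> v \<in> P"
    and md_minus: "v \<in> carrier X \<Longrightarrow> md v \<ominus> v \<in> P"
    and md_smult: "v \<in> carrier X \<Longrightarrow> md (k \<odot> v) = \<bar>k\<bar> \<odot> md v"
    and md_orth_le: "u \<in> carrier X \<Longrightarrow> v \<in> carrier X \<Longrightarrow> w \<in> carrier X \<Longrightarrow>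
      md (u \<ominus> v) = u \<oplus> v \<Longrightarrow> w \<in> P \<Longrightarrow> v \<ominus> w \<in> P \<Longrightarrow> md (u \<ominus> w) = u \<oplus> w"
    and md_orth_md_add: "u \<in> carrier X \<Longrightarrow> v \<in> carrier X \<Longrightarrow> w \<in> carrier X \<Longrightarrow>
      md (u \<ominus> v) = u \<oplus> v \<Longrightarrow> md (u \<ominus> w) = u \<oplus> w \<Longrightarrow>
      md (u \<ominus> md (v \<oplus> w)) = u \<oplus> md (v \<oplus> w)"
    and md_orth_md_diff: "u \<in> carrier X \<Longrightarrow> v \<in> carrier X \<Longrightarrow> w \<in> carrier X \<Longrightarrow>
      md (u \<ominus> v) = u \<oplus> v \<Longrightarrow> md (u \<ominus> w) = u \<oplus> w \<Longrightarrow>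
      md (u \<ominus> md (v \<ominus> w)) = u \<oplus> md (v \<ominus> w)"


section \<open>Matrix ordered spaces\<close>

text \<open>\<open>M\<^bsub>m,n\<^esub>(V)\<close> is \<open>carrier_mat m n\<close> for \<open>m, n \<ge> 1\<close>; as for \<^typ>\<open>'a fmat\<close>,
  the product is taken with respect to a product of the entries.\<close>

definition mprod ::
  "('a \<Rightarrow> 'b \<Rightarrow> 'c::comm_monoid_add) \<Rightarrow> 'a mat \<Rightarrow> 'b mat \<Rightarrow> 'c mat" where
  "mprod f A B =
    mat (dim_row A) (dim_col B) (\<lambda>(i, j). \<Sum>k<dim_col A. f (A $$ (i, k)) (B $$ (k, j)))"

definition mstar :: "('a \<Rightarrow> 'a) \<Rightarrow> 'a mat \<Rightarrow> 'a mat" where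
  "mstar s A = map_mat s (transpose_mat A)"

definition vnorm :: "complex vec \<Rightarrow> real" where
  "vnorm x = L2_set (\<lambda>i. cmod (x $ i)) {..<dim_vec x}"

definition mnorm :: "complex mat \<Rightarrow> real" where
  "mnorm A = (SUP x \<in> {x \<in> carrier_vec (dim_col A). vnorm x \<le> 1}. vnorm (A *\<^sub>v x))"

definition mat_sa_space ::
  "(complex \<Rightarrow> 'v::ab_group_add \<Rightarrow> 'v) \<Rightarrow> ('v \<Rightarrow> 'v) \<Rightarrow> nat \<Rightarrow> (real, 'v mat) Module.module"
  where
  "mat_sa_space scale star n =
    \<lparr>carrier = {v \<in> carrier_mat n n. mstar star v = v}, monoid.mult = undefined, one = undefined,
     zero = 0\<^sub>m n n, add = (+), module.smult = (\<lambda>k. map_mat (scale (of_real k)))\<rparr>"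

locale matrix_ordered_space = vector_space scale
  for scale :: "complex \<Rightarrow> 'v::ab_group_add \<Rightarrow> 'v" +
  fixes star :: "'v \<Rightarrow> 'v"
    and pos :: "nat \<Rightarrow> 'v mat set"
  assumes star_add: "star (x + y) = star x + star y"
    and star_scale: "star (scale c x) = scale (cnj c) (star x)"
    and star_star: "star (star x) = x"
    and ordered: "1 \<le> n \<Longrightarrow> real_ordered_space (mat_sa_space scale star n) (pos n)"
    and pos_conj: "1 \<le> m \<Longrightarrow> 1 \<le> n \<Longrightarrow> v \<in> pos n \<Longrightarrow> a \<in> carrier_mat n m \<Longrightarrow>
      mprod (\<lambda>x c. scale c x) (mprod scale (mat_adjoint a) v) a \<in> pos m"
begin

abbreviation lmult :: "complex mat \<Rightarrow> 'v mat \<Rightarrow> 'v mat" where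
  "lmult \<equiv> mprod scale"

abbreviation rmult :: "'v mat \<Rightarrow> complex mat \<Rightarrow> 'v mat" where
  "rmult \<equiv> mprod (\<lambda>x c. scale c x)"

end

text \<open>\<open>md m n\<close> is the map \<open>|\<cdot>|\<^bsub>m,n\<^esub>\<close>.\<close>

locale absolutely_matrix_ordered_space = matrix_ordered_space scale star pos
  for scale :: "complex \<Rightarrow> 'v::ab_group_add \<Rightarrow> 'v"
    and star :: "'v \<Rightarrow> 'v"
    and pos :: "nat \<Rightarrow> 'v mat set" +
  fixes md :: "nat \<Rightarrow> nat \<Rightarrow> 'v mat \<Rightarrow> 'v mat"
  assumes md_pos: "1 \<le> m \<Longrightarrow> 1 \<le> n \<Longrightarrow> v \<in> carrier_mat m n \<Longrightarrow> md m n v \<in> pos n"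
    and absolutely_ordered:
      "1 \<le> n \<Longrightarrow> absolutely_ordered_space (mat_sa_space scale star n) (pos n) (md n n)"
    and md_mult: "1 \<le> m \<Longrightarrow> 1 \<le> n \<Longrightarrow> 1 \<le> r \<Longrightarrow> 1 \<le> s \<Longrightarrow>
      v \<in> carrier_mat m n \<Longrightarrow> a \<in> carrier_mat r m \<Longrightarrow> b \<in> carrier_mat n s \<Longrightarrow>
      map_mat (scale (of_real (mnorm a))) (md n s (rmult (md m n v) b))
        - md r s (rmult (lmult a v) b) \<in> pos s"
    and md_block: "1 \<le> m \<Longrightarrow> 1 \<le> n \<Longrightarrow> 1 \<le> r \<Longrightarrow> 1 \<le> s \<Longrightarrow>
      v \<in> carrier_mat m n \<Longrightarrow> w \<in> carrier_mat r s \<Longrightarrow>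
      md (m + r) (n + s) (diag_block_mat [v, w]) = diag_block_mat [md m n v, md r s w]"


section \<open>The matricial inductive limit\<close>

text \<open>The inductive limit of the spaces \<open>M\<^sub>n(V)\<close> is the type \<^typ>\<open>'v fmat\<close>,
  with \<open>limT n\<close> as canonical map \<open>T\<^sub>n\<close>.\<close>

definition lim_lact ::
  "(complex \<Rightarrow> 'v::ab_group_add \<Rightarrow> 'v) \<Rightarrow> complex fmat \<Rightarrow> 'v fmat \<Rightarrow> 'v fmat" where
  "lim_lact scale a v = fprod scale a v"

definition lim_ract ::
  "(complex \<Rightarrow> 'v::ab_group_add \<Rightarrow> 'v) \<Rightarrow> 'v fmat \<Rightarrow> complex fmat \<Rightarrow> 'v fmat" where
  "lim_ract scale v a = fprod (\<lambda>x c. scale c x) v a"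

lift_definition limT :: "nat \<Rightarrow> 'v::zero mat \<Rightarrow> 'v fmat"
  is "\<lambda>n v i j. if i < n \<and> j < n then v $$ (i, j) else 0"
  subgoal for n v by (rule finite_subset[of _ "{..<n} \<times> {..<n}"]) auto
  done

definition limT_inv :: "nat \<Rightarrow> 'v::zero fmat \<Rightarrow> 'v mat" where
  "limT_inv n = the_inv_into (carrier_mat n n) (limT n)"

definition lim_pos :: "(nat \<Rightarrow> 'v::zero mat set) \<Rightarrow> 'v fmat set" where
  "lim_pos pos = (\<Union>n\<in>{1..}. limT n ` pos n)"

definition lim_order :: "(complex \<Rightarrow> 'v::ab_group_add \<Rightarrow> 'v) \<Rightarrow> 'v fmat \<Rightarrow> nat" where
  "lim_order scale = bimod_order (lim_lact scale) (lim_ract scale)"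

definition lim_md ::
  "(complex \<Rightarrow> 'v::ab_group_add \<Rightarrow> 'v) \<Rightarrow> (nat \<Rightarrow> nat \<Rightarrow> 'v mat \<Rightarrow> 'v mat) \<Rightarrow>
    'v fmat \<Rightarrow> 'v fmat" where
  "lim_md scale md v =
    (let n = lim_order scale v in limT n (md n n (limT_inv n v)))"

end

theory Submission
  imports Defs
begin

text \<open>If \<open>v\<close> is supported in the first \<open>N\<close> rows and columns, then applying
  \<open>\<bar>v \<oplus> 0\<bar> = \<bar>v\<bar> \<oplus> 0\<close> shows that the modulus of \<open>v\<close> may be computed in
  \<open>M\<^bsub>N\<^esub>(V)\<close> instead of at the order of \<open>v\<close>. Every axiom involves finitely many elements,
  so it can be checked for one common \<open>N\<close>. Two axioms need more than this. Positivity of the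
  block matrix with entries \<open>\<bar>v\<^sup>*\<bar>, v, v\<^sup>*, \<bar>v\<bar>\<close> holds since its off-diagonal part is
  \<open>v\<^sup>* \<oplus> v\<close> multiplied by a permutation matrix. For independent \<open>u\<close> and \<open>v\<close>, conjugation
  by a permutation matrix, which commutes with the modulus, turns \<open>u + v\<close> into a direct
  sum.\<close>

section \<open>Corners of infinite matrices\<close>

text \<open>One set bounds rows and columns alike, since order and F-independence are both defined
  by two-sided compressions with the same diagonal projection.\<close>

definition supported :: "nat set \<Rightarrow> 'a::zero fmat \<Rightarrow> bool" where
  "supported S v \<longleftrightarrow> (\<forall>i j. entry v i j \<noteq> 0 \<longrightarrow> i \<in> S \<and> j \<in> S)"

text \<open>A total substitute for the inverse of the canonical map \<open>limT n\<close>: it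
  truncates every element and inverts \<open>limT n\<close> on those supported in the first
  \<open>n\<close> indices.\<close>

definition corner :: "nat \<Rightarrow> 'a::zero fmat \<Rightarrow> 'a mat" where
  "corner n v = mat n n (\<lambda>(i, j). entry v i j)"

lemma supported_mono: "supported S v \<Longrightarrow> S \<subseteq> T \<Longrightarrow> supported T v"
  unfolding supported_def by blast

lemma supportedD: "supported S v \<Longrightarrow> i \<notin> S \<or> j \<notin> S \<Longrightarrow> entry v i j = 0"
  unfolding supported_def by blast

lemma ex_supported: "\<exists>N. supported {..<N} v"
proof -
  have fin: "finite {(i, j). entry v i j \<noteq> 0}" using entry[of v] by auto
  obtain N where "\<forall>p\<in>{(i, j). entry v i j \<noteq> 0}. max (fst p) (snd p) < N"
    using finite_nat_set_iff_bounded[of "(\<lambda>p. max (fst p) (snd p)) ` {(i, j). entry v i j \<noteq> 0}"] fin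
    by auto
  then show ?thesis unfolding supported_def by (intro exI[of _ N]) force
qed

text \<open>The axioms involve at most three elements at a time, possibly scalar matrices and
  elements of the limit together. The lower bound \<open>M\<close> serves to keep sizes positive, as
  matrix spaces are only considered from size 1 on.\<close>

lemma ex_supported3:
  obtains N where "M \<le> N" "supported {..<N} u" "supported {..<N} v" "supported {..<N} w"
proof -
  obtain N1 N2 N3 where "supported {..<N1} u" "supported {..<N2} v" "supported {..<N3} w"
    using ex_supported by metis
  then have "supported {..<M + N1 + N2 + N3} u" "supported {..<M + N1 + N2 + N3} v"
    "supported {..<M + N1 + N2 + N3} w"
    by (auto elim: supported_mono)
  then show thesis by (intro that[of "M + N1 + N2 + N3"]) auto
qed

lemma supported_add: "supported S u \<Longrightarrow> supported S v \<Longrightarrow> supported S (u + v)"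
  unfolding supported_def plus_fmat.rep_eq by (metis add_0)

lemma supported_diff: "supported S u \<Longrightarrow> supported S v \<Longrightarrow> supported S (u - v)"
  unfolding supported_def minus_fmat.rep_eq by (metis diff_self)

lemma entry_sum: "entry (sum f S) i j = (\<Sum>x\<in>S. entry (f x) i j)"
  by (induction S rule: infinite_finite_induct) (auto simp: zero_fmat.rep_eq plus_fmat.rep_eq)

lemma entry_fdiag: "finite S \<Longrightarrow> entry (fdiag S) i j = (if i = j \<and> i \<in> S then 1 else 0)"
proof -
  assume S: "finite S"
  have "entry (fdiag S) i j = (\<Sum>x\<in>S. if x = i then (if i = j then 1 else 0) else 0)"
    unfolding fdiag_def entry_sum funit.rep_eq by (intro sum.cong) auto
  then show ?thesis using S by simp
qed

lemma fI_eq_fdiag: "fI n = fdiag {..<n}"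
  unfolding fI_def fdiag_def ..

lemma entry_fJ: "entry (fJ n) i j = (if i < n \<and> j = n + i then 1 else 0)"
proof -
  have "entry (fJ n) i j = (\<Sum>x<n. if x = i then (if j = n + i then 1 else 0) else 0)"
    unfolding fJ_def entry_sum funit.rep_eq by (intro sum.cong) auto
  then show ?thesis by simp
qed

lemma entry_fstar: "s 0 = 0 \<Longrightarrow> entry (fstar s A) i j = s (entry A j i)"
  by (simp add: fstar.rep_eq)

lemma supported_fstar: "supported S v \<Longrightarrow> supported S (fstar s v)"
  unfolding supported_def fstar.rep_eq by (metis (full_types))

lemma supported_fprod:
  assumes "supported S A" "supported S B"
  shows "supported S (fprod f A B)"
  unfolding supported_def
proof (intro allI impI)
  fix i j assume "entry (fprod f A B) i j \<noteq> 0"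
  then obtain k where "entry A i k \<noteq> 0" "entry B k j \<noteq> 0"
    unfolding fprod.rep_eq using sum.not_neutral_contains_not_neutral by blast
  then show "i \<in> S \<and> j \<in> S" using assms by (auto simp: supported_def)
qed

lemma entry_times:
  assumes "supported {..<N} (a :: complex fmat) \<or> supported {..<N} b"
  shows "entry (a * b) i j = (\<Sum>k<N. entry a i k * entry b k j)"
  unfolding times_fmat_def by (rule entry_fprod) (use assms in \<open>auto simp: supported_def\<close>)

section \<open>Corners and the canonical maps\<close>

lemma corner_carrier [simp]: "corner n v \<in> carrier_mat n n"
  unfolding corner_def by simp

lemma corner_dims [simp]: "dim_row (corner n v) = n" "dim_col (corner n v) = n"
  unfolding corner_def by auto

lemma corner_index [simp]: "i < n \<Longrightarrow> j < n \<Longrightarrow> corner n v $$ (i, j) = entry v i j"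
  unfolding corner_def by simp

lemma limT_corner: "supported {..<n} v \<Longrightarrow> limT n (corner n v) = v"
  by (rule fmat_eqI) (auto simp: limT.rep_eq supported_def)

lemma corner_limT: "A \<in> carrier_mat n n \<Longrightarrow> corner n (limT n A) = A"
  by (rule eq_matI) (auto simp: limT.rep_eq)

lemma supported_limT: "supported {..<n} (limT n A)"
  by (auto simp: supported_def limT.rep_eq)

lemma inj_on_limT: "inj_on (limT n) (carrier_mat n n)"
  by (metis corner_limT inj_onI)

lemma limT_inv_eq: "supported {..<n} v \<Longrightarrow> limT_inv n v = corner n v"
  unfolding limT_inv_def
  using the_inv_into_f_f[OF inj_on_limT corner_carrier] limT_corner by metis

lemma limT_add: "A \<in> carrier_mat n n \<Longrightarrow> B \<in> carrier_mat n n \<Longrightarrow> limT n (A + B) = limT n A + limT n B"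
  by (rule fmat_eqI) (auto simp: limT.rep_eq plus_fmat.rep_eq)

lemma corner_add: "corner n (u + v) = corner n u + corner n v"
  by (rule eq_matI) (auto simp: plus_fmat.rep_eq)

lemma corner_diff: "corner n (u - v) = corner n u - corner n v"
  by (rule eq_matI) (auto simp: minus_fmat.rep_eq)

section \<open>Entries of block diagonal matrices and adjoints\<close>

lemma diag_block_mat_index:
  assumes "A \<in> carrier_mat m n" "B \<in> carrier_mat r s" "i < m + r" "j < n + s"
  shows "diag_block_mat [A, B] $$ (i, j) =
    (if i < m then if j < n then A $$ (i, j) else 0
     else if j < n then 0 else B $$ (i - m, j - n))"
  using assms by (auto simp: Let_def)

lemma diag_block_mat_carrier:
  "A \<in> carrier_mat m n \<Longrightarrow> B \<in> carrier_mat r s \<Longrightarrow> diag_block_mat [A, B] \<in> carrier_mat (m + r) (n + s)"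
  by (auto simp: Let_def)

lemma eq_diag_block_matI:
  assumes "A \<in> carrier_mat m n" "B \<in> carrier_mat r s" "C \<in> carrier_mat (m + r) (n + s)"
    and "\<And>i j. i < m + r \<Longrightarrow> j < n + s \<Longrightarrow> C $$ (i, j) =
      (if i < m then if j < n then A $$ (i, j) else 0
       else if j < n then 0 else B $$ (i - m, j - n))"
  shows "C = diag_block_mat [A, B]"
  by (rule eq_matI)
    (use assms diag_block_mat_carrier[OF assms(1,2)] diag_block_mat_index[OF assms(1,2)]
      in \<open>auto simp del: diag_block_mat.simps\<close>)

lemma mat_adjoint_index:
  fixes A :: "complex mat"
  assumes "i < dim_col A" "j < dim_row A"
  shows "mat_adjoint A $$ (i, j) = cnj (A $$ (j, i))"
  using assms unfolding mat_adjoint_def by (auto simp: mat_of_rows_def)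

lemma mat_adjoint_dims [simp]:
  "dim_row (mat_adjoint A) = dim_col A" "dim_col (mat_adjoint A) = dim_row A"
  unfolding mat_adjoint_def by auto

section \<open>Operator norms\<close>

text \<open>The Cauchy-Schwarz inequality in squared form.\<close>

lemma cmod_sum_mult_le:
  "(cmod (\<Sum>k\<in>K. f k * g k))\<^sup>2 \<le> (\<Sum>k\<in>K. (cmod (f k))\<^sup>2) * (\<Sum>k\<in>K. (cmod (g k))\<^sup>2)"
proof -
  have "cmod (\<Sum>k\<in>K. f k * g k) \<le> (\<Sum>k\<in>K. \<bar>cmod (f k)\<bar> * \<bar>cmod (g k)\<bar>)"
    by (rule order_trans[OF norm_sum]) (simp add: norm_mult)
  also have "\<dots> \<le> L2_set (\<lambda>k. cmod (f k)) K * L2_set (\<lambda>k. cmod (g k)) K"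
    by (rule L2_set_mult_ineq)
  finally have "(cmod (\<Sum>k\<in>K. f k * g k))\<^sup>2 \<le> (L2_set (\<lambda>k. cmod (f k)) K * L2_set (\<lambda>k. cmod (g k)) K)\<^sup>2"
    by (rule power_mono) simp
  then show ?thesis
    by (simp add: L2_set_def power_mult_distrib sum_nonneg)
qed

text \<open>Extension by zeros maps the unit ball of the \<open>N\<close>-dimensional space into
  that of the sequence space and preserves the norm of the image, so the right-hand supremum
  dominates.\<close>

lemma mnorm_corner_le_fnorm:
  assumes a: "supported {..<N} a"
  shows "mnorm (corner N a) \<le> fnorm a"
proof -
  let ?X = "{x :: nat \<Rightarrow> complex. summable (\<lambda>k. (cmod (x k))\<^sup>2) \<and> (\<Sum>k. (cmod (x k))\<^sup>2) \<le> 1}"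
  let ?F = "\<lambda>x. sqrt (\<Sum>i. (cmod (\<Sum>k. entry a i k * x k))\<^sup>2)"
  have inner: "(\<Sum>k. entry a i k * x k) = (\<Sum>k<N. entry a i k * x k)" for i x
    by (rule suminf_finite) (use supportedD[OF a] in auto)
  have F: "?F x = sqrt (\<Sum>i<N. (cmod (\<Sum>k<N. entry a i k * x k))\<^sup>2)" for x
    unfolding inner by (subst suminf_finite[of "{..<N}"]) (use supportedD[OF a] in auto)
  \<comment> \<open>A real supremum bounds its set from above only if the set is bounded. The
    Hilbert-Schmidt norm of \<open>a\<close> serves as a bound, by Cauchy-Schwarz in each
    row.\<close>
  have bdd: "bdd_above (?F ` ?X)"
  proof (rule bdd_aboveI2)
    fix x assume x: "x \<in> ?X"
    have "(cmod (\<Sum>k<N. entry a i k * x k))\<^sup>2 \<le> (\<Sum>k<N. (cmod (entry a i k))\<^sup>2)" for i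
    proof -
      have "(\<Sum>k<N. (cmod (x k))\<^sup>2) \<le> (\<Sum>k. (cmod (x k))\<^sup>2)"
        by (rule sum_le_suminf) (use x in auto)
      also have "\<dots> \<le> 1" using x by simp
      finally have "(\<Sum>k<N. (cmod (entry a i k))\<^sup>2) * (\<Sum>k<N. (cmod (x k))\<^sup>2)
          \<le> (\<Sum>k<N. (cmod (entry a i k))\<^sup>2) * 1"
        by (intro mult_left_mono) (auto intro: sum_nonneg)
      then show ?thesis
        using cmod_sum_mult_le[of "entry a i" x "{..<N}"] by linarith
    qed
    then show "?F x \<le> sqrt (\<Sum>i<N. \<Sum>k<N. (cmod (entry a i k))\<^sup>2)"
      unfolding F by (intro real_sqrt_le_mono sum_mono) auto
  qed
  show ?thesis unfolding mnorm_def
  proof (rule cSUP_least)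
    show "{x \<in> carrier_vec (dim_col (corner N a)). vnorm x \<le> 1} \<noteq> {}"
      by (auto intro!: exI[of _ "0\<^sub>v N"] simp: vnorm_def L2_set_def)
  next
    fix x assume "x \<in> {x \<in> carrier_vec (dim_col (corner N a)). vnorm x \<le> 1}"
    then have x: "dim_vec x = N" "vnorm x \<le> 1" by auto
    define y where "y k = (if k < N then x $ k else 0)" for k
    have y: "(\<lambda>k. (cmod (y k))\<^sup>2) sums (\<Sum>k<N. (cmod (y k))\<^sup>2)"
      by (rule sums_finite) (auto simp: y_def)
    have "(\<Sum>k<N. (cmod (y k))\<^sup>2) \<le> 1"
      using x by (simp add: vnorm_def L2_set_def y_def)
    then have "y \<in> ?X" using y by (auto simp: sums_iff)
    then have "?F y \<le> fnorm a" unfolding fnorm_def by (rule cSUP_upper[OF _ bdd])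
    moreover have "vnorm (corner N a *\<^sub>v x) = ?F y"
      unfolding F vnorm_def L2_set_def using x
      by (intro arg_cong[of _ _ sqrt] sum.cong)
        (auto simp: scalar_prod_def y_def atLeast0LessThan intro!: arg_cong[of _ _ "\<lambda>z. (cmod z)\<^sup>2"] sum.cong)
    ultimately show "vnorm (corner N a *\<^sub>v x) \<le> fnorm a" by simp
  qed
qed

section \<open>Permutation matrices\<close>

definition perm_mat :: "nat \<Rightarrow> (nat \<Rightarrow> nat) \<Rightarrow> complex mat" where
  "perm_mat n \<sigma> = mat n n (\<lambda>(i, k). if k = \<sigma> i then 1 else 0)"

lemma perm_mat_carrier [simp]: "perm_mat n \<sigma> \<in> carrier_mat n n"
  unfolding perm_mat_def by simp

text \<open>A permutation of the coordinates is an isometry.\<close>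

lemma mnorm_perm_mat_le_1:
  assumes \<sigma>: "\<sigma> permutes {..<n}"
  shows "mnorm (perm_mat n \<sigma>) \<le> 1"
  unfolding mnorm_def
proof (rule cSUP_least)
  show "{x \<in> carrier_vec (dim_col (perm_mat n \<sigma>)). vnorm x \<le> 1} \<noteq> {}"
    by (auto intro!: exI[of _ "0\<^sub>v n"] simp: vnorm_def L2_set_def perm_mat_def)
next
  fix x assume "x \<in> {x \<in> carrier_vec (dim_col (perm_mat n \<sigma>)). vnorm x \<le> 1}"
  then have x: "dim_vec x = n" "vnorm x \<le> 1" by (auto simp: perm_mat_def)
  have \<sigma>n: "\<sigma> i < n" if "i < n" for i
    using permutes_in_image[OF \<sigma>] that by auto
  have ind: "(perm_mat n \<sigma> *\<^sub>v x) $ i = x $ \<sigma> i" if "i < n" for i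
  proof -
    have "(perm_mat n \<sigma> *\<^sub>v x) $ i = (\<Sum>k<n. if k = \<sigma> i then x $ \<sigma> i else 0)"
      using that x unfolding perm_mat_def
      by (simp add: scalar_prod_def atLeast0LessThan if_distrib[of "\<lambda>c. c * _"] cong: if_cong)
    then show ?thesis using \<sigma>n[OF that] by simp
  qed
  have "(\<Sum>i<n. (cmod ((perm_mat n \<sigma> *\<^sub>v x) $ i))\<^sup>2) = (\<Sum>i<n. (cmod (x $ \<sigma> i))\<^sup>2)"
    using ind by simp
  also have "\<dots> = (\<Sum>i<n. (cmod (x $ i))\<^sup>2)"
    using sum.permute[OF \<sigma>, of "\<lambda>i. (cmod (x $ i))\<^sup>2"] by (simp add: o_def)
  finally have "vnorm (perm_mat n \<sigma> *\<^sub>v x) = vnorm x"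
    using x unfolding vnorm_def L2_set_def by (simp add: perm_mat_def)
  then show "vnorm (perm_mat n \<sigma> *\<^sub>v x) \<le> 1" using x by simp
qed

text \<open>A bijection from the first \<open>card K\<close> indices onto \<open>K\<close> is glued
  to one between the complements. Reindexing by \<sigma> moves the indices in \<open>K\<close> to
  the front, which later brings sums of independent elements into block diagonal form.\<close>

lemma ex_permutes_image_lessThan:
  assumes "K \<subseteq> {..<N::nat}"
  obtains \<sigma> where "\<sigma> permutes {..<N}" "\<And>i. i < N \<Longrightarrow> \<sigma> i \<in> K \<longleftrightarrow> i < card K"
proof -
  have K: "finite K" using assms finite_subset by blast
  have cK: "card K \<le> N" using card_mono[OF _ assms] by simp
  obtain f where f: "bij_betw f {..<card K} K"
    using finite_same_card_bij[of "{..<card K}" K] K by auto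
  obtain g where g: "bij_betw g {card K..<N} ({..<N} - K)"
    using finite_same_card_bij[of "{card K..<N}" "{..<N} - K"] K assms by (auto simp: card_Diff_subset)
  define \<sigma> where "\<sigma> i = (if i < card K then f i else if i < N then g i else i)" for i
  have f': "bij_betw \<sigma> {..<card K} K" using f by (rule bij_betw_cong[THEN iffD1, rotated]) (auto simp: \<sigma>_def)
  have g': "bij_betw \<sigma> {card K..<N} ({..<N} - K)"
    using g by (rule bij_betw_cong[THEN iffD1, rotated]) (auto simp: \<sigma>_def)
  have "bij_betw \<sigma> ({..<card K} \<union> {card K..<N}) (K \<union> ({..<N} - K))"
    by (rule bij_betw_combine[OF f' g']) auto
  moreover have "{..<card K} \<union> {card K..<N} = {..<N}" "K \<union> ({..<N} - K) = {..<N}"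
    using cK assms by auto
  ultimately have "\<sigma> permutes {..<N}"
    using cK by (intro bij_imp_permutes) (auto simp: \<sigma>_def)
  moreover have "\<sigma> i \<in> K \<longleftrightarrow> i < card K" if "i < N" for i
    using bij_betw_apply[OF f', of i] bij_betw_apply[OF g', of i] that by (cases "i < card K") auto
  ultimately show thesis using that by blast
qed

section \<open>The bimodule structure of the inductive limit\<close>

locale complex_space = vector_space scale
  for scale :: "complex \<Rightarrow> 'v::ab_group_add \<Rightarrow> 'v"
begin

abbreviation lact (infixr \<open>\<triangleright>\<close> 75) where "lact \<equiv> lim_lact scale"
abbreviation ract (infixl \<open>\<triangleleft>\<close> 74) where "ract \<equiv> lim_ract scale"

lemma entry_lact:
  assumes "supported {..<N} a \<or> supported {..<N} v"
  shows "entry (a \<triangleright> v) i j = (\<Sum>k<N. scale (entry a i k) (entry v k j))"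
  unfolding lim_lact_def by (rule entry_fprod) (use assms in \<open>auto simp: supported_def\<close>)

lemma entry_ract:
  assumes "supported {..<N} v \<or> supported {..<N} a"
  shows "entry (v \<triangleleft> a) i j = (\<Sum>k<N. scale (entry a k j) (entry v i k))"
  unfolding lim_ract_def by (rule entry_fprod) (use assms in \<open>auto simp: supported_def\<close>)

text \<open>Diagonal projections and the adjoint of \<open>fJ n\<close> have only zero rows and unit
  rows. A unit row copies one row of \<open>v\<close>, so this lemma and the next evaluate all such
  products without a choice of size; the two after them do the same for columns.\<close>

lemma entry_lact_unit:
  assumes "\<And>l. entry a i l = (if l = k then 1 else 0)"
  shows "entry (a \<triangleright> v) i j = entry v k j"
proof -
  have "entry (a \<triangleright> v) i j = (\<Sum>l\<in>{k}. scale (entry a i l) (entry v l j))"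
    unfolding lim_lact_def by (rule entry_fprod) (use assms in auto)
  then show ?thesis using assms by simp
qed

lemma entry_lact_zero: "(\<And>l. entry a i l = 0) \<Longrightarrow> entry (a \<triangleright> v) i j = 0"
  unfolding lim_lact_def by (subst entry_fprod[of "{}"]) auto

lemma entry_ract_unit:
  assumes "\<And>l. entry a l j = (if l = k then 1 else 0)"
  shows "entry (v \<triangleleft> a) i j = entry v i k"
proof -
  have "entry (v \<triangleleft> a) i j = (\<Sum>l\<in>{k}. scale (entry a l j) (entry v i l))"
    unfolding lim_ract_def by (rule entry_fprod) (use assms in auto)
  then show ?thesis using assms by simp
qed

lemma entry_ract_zero: "(\<And>l. entry a l j = 0) \<Longrightarrow> entry (v \<triangleleft> a) i j = 0"
  unfolding lim_ract_def by (subst entry_fprod[of "{}"]) auto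

lemma entry_fdiag_lact:
  "finite S \<Longrightarrow> entry (fdiag S \<triangleright> v) i j = (if i \<in> S then entry v i j else 0)"
  using entry_lact_unit[of "fdiag S" i i v j] entry_lact_zero[of "fdiag S" i v j]
  by (auto simp: entry_fdiag)

lemma entry_ract_fdiag:
  "finite S \<Longrightarrow> entry (v \<triangleleft> fdiag S) i j = (if j \<in> S then entry v i j else 0)"
  using entry_ract_unit[of "fdiag S" j j v i] entry_ract_zero[of "fdiag S" j v i]
  by (auto simp: entry_fdiag)

text \<open>This turns the compressions that define non-degeneracy, order and F-independence into
  conditions on entries.\<close>

lemma fdiag_compress_iff: "finite S \<Longrightarrow> fdiag S \<triangleright> v \<triangleleft> fdiag S = v \<longleftrightarrow> supported S v"
  by (auto simp: entry_ract_fdiag entry_fdiag_lact supported_def intro!: fmat_eqI split: if_splits)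
    (metis entry_ract_fdiag entry_fdiag_lact)+

lemma fI_compress_iff: "(fI n \<triangleright> v) \<triangleleft> fI n = v \<longleftrightarrow> supported {..<n} v"
  using fdiag_compress_iff[of "{..<n}" v] by (simp add: fI_eq_fdiag)

lemma lact_assoc: "(a * b) \<triangleright> v = a \<triangleright> b \<triangleright> v"
proof (rule fmat_eqI)
  fix i j
  obtain N where N: "supported {..<N} a" "supported {..<N} b" using ex_supported3 by metis
  have "entry ((a * b) \<triangleright> v) i j = (\<Sum>k<N. scale (entry (a * b) i k) (entry v k j))"
    by (rule entry_lact) (simp add: N times_fmat_def supported_fprod)
  also have "\<dots> = (\<Sum>k<N. \<Sum>l<N. scale (entry a i l) (scale (entry b l k) (entry v k j)))"
    using N by (simp add: entry_times[of N] scale_sum_left)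
  also have "\<dots> = (\<Sum>l<N. \<Sum>k<N. scale (entry a i l) (scale (entry b l k) (entry v k j)))"
    by (rule sum.swap)
  also have "\<dots> = entry (a \<triangleright> b \<triangleright> v) i j"
    using N by (simp add: entry_lact[of N] scale_sum_right)
  finally show "entry ((a * b) \<triangleright> v) i j = entry (a \<triangleright> b \<triangleright> v) i j" .
qed

lemma ract_assoc: "v \<triangleleft> (a * b) = v \<triangleleft> a \<triangleleft> b"
proof (rule fmat_eqI)
  fix i j
  obtain N where N: "supported {..<N} a" "supported {..<N} b" using ex_supported3 by metis
  have "entry (v \<triangleleft> (a * b)) i j = (\<Sum>k<N. scale (entry (a * b) k j) (entry v i k))"
    by (rule entry_ract) (simp add: N times_fmat_def supported_fprod)
  also have "\<dots> = (\<Sum>k<N. \<Sum>l<N. scale (entry b l j) (scale (entry a k l) (entry v i k)))"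
    using N by (simp add: entry_times[of N] scale_sum_left mult.commute)
  also have "\<dots> = (\<Sum>l<N. \<Sum>k<N. scale (entry b l j) (scale (entry a k l) (entry v i k)))"
    by (rule sum.swap)
  also have "\<dots> = entry (v \<triangleleft> a \<triangleleft> b) i j"
    using N by (simp add: entry_ract[of N] scale_sum_right)
  finally show "entry (v \<triangleleft> (a * b)) i j = entry (v \<triangleleft> a \<triangleleft> b) i j" .
qed

lemma F_bimodule_lim: "F_bimodule (lim_lact scale) (lim_ract scale)"
proof
  fix a b :: "complex fmat" and u v :: "'v fmat" and c :: complex
  obtain N where N: "supported {..<N} a" "supported {..<N} b" using ex_supported3 by metis
  have N': "supported {..<N} (a + b)"
    by (rule supported_add[OF N])
  have N'': "supported {..<N} (fsmult c a)" "supported {..<N} (fsmult c b)"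
    using N by (auto simp: supported_def fsmult.rep_eq)
  note e = entry_lact[of N] entry_ract[of N] N N' N'' plus_fmat.rep_eq
  show "(a + b) \<triangleright> v = (a \<triangleright> v) + (b \<triangleright> v)"
    by (rule fmat_eqI) (simp add: e scale_left_distrib sum.distrib)
  show "a \<triangleright> (u + v) = (a \<triangleright> u) + (a \<triangleright> v)"
    by (rule fmat_eqI) (simp add: e scale_right_distrib sum.distrib)
  show "(u + v) \<triangleleft> a = (u \<triangleleft> a) + (v \<triangleleft> a)"
    by (rule fmat_eqI) (simp add: e scale_right_distrib sum.distrib)
  show "v \<triangleleft> (a + b) = (v \<triangleleft> a) + (v \<triangleleft> b)"
    by (rule fmat_eqI) (simp add: e scale_left_distrib sum.distrib)
  show "(a * b) \<triangleright> v = a \<triangleright> b \<triangleright> v" by (rule lact_assoc)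
  show "v \<triangleleft> (a * b) = v \<triangleleft> a \<triangleleft> b" by (rule ract_assoc)
  show "(a \<triangleright> v) \<triangleleft> b = a \<triangleright> (v \<triangleleft> b)"
  proof (rule fmat_eqI)
    fix i j
    have "entry ((a \<triangleright> v) \<triangleleft> b) i j = (\<Sum>k<N. \<Sum>l<N. scale (entry b k j) (scale (entry a i l) (entry v l k)))"
      by (simp add: e scale_sum_right)
    also have "\<dots> = (\<Sum>l<N. \<Sum>k<N. scale (entry b k j) (scale (entry a i l) (entry v l k)))"
      by (rule sum.swap)
    also have "\<dots> = entry (a \<triangleright> (v \<triangleleft> b)) i j"
      by (simp add: e scale_sum_right mult.commute)
    finally show "entry ((a \<triangleright> v) \<triangleleft> b) i j = entry (a \<triangleright> (v \<triangleleft> b)) i j" .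
  qed
  show "(fsmult c a \<triangleright> v) \<triangleleft> b = (a \<triangleright> v) \<triangleleft> fsmult c b"
    by (rule fmat_eqI) (simp add: e scale_sum_right fsmult.rep_eq mult_ac)
qed

section \<open>Order and scalar multiplication\<close>

lemma lim_order_props: "1 \<le> lim_order scale v" "supported {..<lim_order scale v} v"
proof -
  obtain N where "1 \<le> N" "supported {..<N} v" using ex_supported3 by metis
  then have "1 \<le> N \<and> (fI N \<triangleright> v) \<triangleleft> fI N = v" by (simp add: fI_compress_iff)
  from LeastI[where P = "\<lambda>n. 1 \<le> n \<and> (fI n \<triangleright> v) \<triangleleft> fI n = v", OF this]
  show "1 \<le> lim_order scale v" "supported {..<lim_order scale v} v"
    unfolding lim_order_def bimod_order_def by (auto simp: fI_compress_iff)
qed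

lemma lim_order_le: "1 \<le> n \<Longrightarrow> supported {..<n} v \<Longrightarrow> lim_order scale v \<le> n"
  unfolding lim_order_def bimod_order_def by (rule Least_le) (simp add: fI_compress_iff)

sublocale lim: F_bimodule "lim_lact scale" "lim_ract scale"
  by (rule F_bimodule_lim)

text \<open>The scalar action, defined through the order of \<open>v\<close>, is the entrywise one:
  the scaled projection multiplies the rows below the order by \<open>c\<close>, and all other rows
  of \<open>v\<close> vanish.\<close>

lemma entry_scal: "entry (lim.scal c v) i j = scale c (entry v i j)"
proof -
  let ?n = "lim_order scale v"
  have s: "entry (fsmult c (fI ?n)) i k = (if k = i \<and> i < ?n then c else 0)" for k
    by (auto simp: fsmult.rep_eq fI_eq_fdiag entry_fdiag)
  have "entry (lim.scal c v) i j = (\<Sum>k<?n. scale (entry (fsmult c (fI ?n)) i k) (entry v k j))"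
    unfolding lim.scal_def lim_order_def[symmetric]
    by (rule entry_lact) (simp add: lim_order_props)
  also have "\<dots> = (\<Sum>k<?n. if k = i then scale c (entry v i j) else 0)"
    unfolding s by (intro sum.cong) auto
  \<comment> \<open>If \<open>i\<close> is not below the order, the sum has no matching index and
    the entry on the right is 0.\<close>
  also have "\<dots> = scale c (entry v i j)"
    using supportedD[OF lim_order_props(2), of i v j] by auto
  finally show ?thesis .
qed

text \<open>Corners are compatible with products as soon as one factor lies in the first
  \<open>N\<close> indices: the sum over the inner index then stops before \<open>N\<close>.\<close>

lemma mprod_corner_lact:
  assumes "supported {..<N} a \<or> supported {..<N} v"
  shows "mprod scale (corner N a) (corner N v) = corner N (a \<triangleright> v)"
  by (rule eq_matI) (auto simp: mprod_def entry_lact[OF assms])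

lemma mprod_corner_ract:
  assumes "supported {..<N} v \<or> supported {..<N} a"
  shows "mprod (\<lambda>x c. scale c x) (corner N v) (corner N a) = corner N (v \<triangleleft> a)"
  by (rule eq_matI) (auto simp: mprod_def entry_ract[OF assms])

lemma supported_lact: "supported S a \<Longrightarrow> supported S v \<Longrightarrow> supported S (a \<triangleright> v)"
  unfolding lim_lact_def by (rule supported_fprod)

lemma supported_ract: "supported S v \<Longrightarrow> supported S a \<Longrightarrow> supported S (v \<triangleleft> a)"
  unfolding lim_ract_def by (rule supported_fprod)

section \<open>Placing blocks with the matrices \<open>fJ n\<close>\<close>

lemma entry_fadjoint_fJ_lact:
  "entry (fadjoint (fJ n) \<triangleright> v) i j = (if n \<le> i \<and> i < n + n then entry v (i - n) j else 0)"
  using entry_lact_unit[of "fadjoint (fJ n)" i "i - n" v j] entry_lact_zero[of "fadjoint (fJ n)" i v j]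
  by (auto simp: entry_fstar entry_fJ)

lemma entry_ract_fJ:
  "entry (v \<triangleleft> fJ n) i j = (if n \<le> j \<and> j < n + n then entry v i (j - n) else 0)"
  using entry_ract_unit[of "fJ n" j "j - n" v i] entry_ract_zero[of "fJ n" j v i]
  by (auto simp: entry_fJ)

text \<open>The leading block of size \<open>n\<close> moves to the second diagonal position. The
  next two lemmas place it in the upper right and in the lower left.\<close>

lemma entry_fJ_conj:
  "entry (fadjoint (fJ n) \<triangleright> v \<triangleleft> fJ n) i j =
    (if n \<le> i \<and> i < n + n \<and> n \<le> j \<and> j < n + n then entry v (i - n) (j - n) else 0)"
  by (simp add: entry_fadjoint_fJ_lact entry_ract_fJ)

lemma entry_fI_fJ:
  "entry (fI n \<triangleright> v \<triangleleft> fJ n) i j =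
    (if i < n \<and> n \<le> j \<and> j < n + n then entry v i (j - n) else 0)"
  by (simp add: fI_eq_fdiag entry_fdiag_lact entry_ract_fJ)

lemma entry_fJ_fI:
  "entry (fadjoint (fJ n) \<triangleright> v \<triangleleft> fI n) i j =
    (if j < n \<and> n \<le> i \<and> i < n + n then entry v (i - n) j else 0)"
  by (simp add: fI_eq_fdiag entry_ract_fdiag entry_fadjoint_fJ_lact)

end

section \<open>Cones and moduli of matrices\<close>

lemma mstar_dims [simp]: "dim_row (mstar s A) = dim_col A" "dim_col (mstar s A) = dim_row A"
  unfolding mstar_def by auto

lemma mstar_index [simp]:
  "i < dim_col A \<Longrightarrow> j < dim_row A \<Longrightarrow> mstar s A $$ (i, j) = s (A $$ (j, i))"
  unfolding mstar_def by auto

sublocale absolutely_matrix_ordered_space \<subseteq> complex_space scale ..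

context absolutely_matrix_ordered_space
begin

section \<open>Self-adjoint matrices as a real ordered space\<close>

definition herm :: "nat \<Rightarrow> 'v mat set" where
  "herm n = {v \<in> carrier_mat n n. mstar star v = v}"

lemma star_zero: "star 0 = 0"
  using star_add[of 0 0] by simp

lemma star_minus: "star (- x) = - star x"
  using star_add[of x "- x"] star_zero by (simp add: minus_unique)

lemma herm_iff: "v \<in> herm n \<longleftrightarrow> v \<in> carrier_mat n n \<and> (\<forall>i<n. \<forall>j<n. star (v $$ (j, i)) = v $$ (i, j))"
  unfolding herm_def by (auto simp: mat_eq_iff)

lemma herm_carrier: "v \<in> herm n \<Longrightarrow> v \<in> carrier_mat n n"
  by (simp add: herm_def)

lemma herm_add: "u \<in> herm n \<Longrightarrow> v \<in> herm n \<Longrightarrow> u + v \<in> herm n"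
  by (auto simp: herm_iff star_add)

lemma herm_uminus: "v \<in> herm n \<Longrightarrow> - v \<in> herm n"
  by (auto simp: herm_iff star_minus)

lemma mat_sa_space_simps:
  "carrier (mat_sa_space scale star n) = herm n"
  "\<zero>\<^bsub>mat_sa_space scale star n\<^esub> = 0\<^sub>m n n"
  "u \<oplus>\<^bsub>mat_sa_space scale star n\<^esub> v = u + v"
  "k \<odot>\<^bsub>mat_sa_space scale star n\<^esub> v = map_mat (scale (of_real k)) v"
  by (simp_all add: mat_sa_space_def herm_def)

text \<open>Subtraction in a module record is addition of the inverse in its additive group.
  Inverses are unique there, so \<open>- v\<close> is the inverse of \<open>v\<close>.\<close>

lemma mat_sa_space_minus:
  assumes "1 \<le> n" "u \<in> herm n" "v \<in> herm n"
  shows "u \<ominus>\<^bsub>mat_sa_space scale star n\<^esub> v = u - v"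
proof -
  interpret X: real_ordered_space "mat_sa_space scale star n" "pos n"
    using ordered assms by blast
  have "- v + v = 0\<^sub>m n n"
    using herm_carrier[OF assms(3)] by (intro eq_matI) auto
  then have "\<ominus>\<^bsub>mat_sa_space scale star n\<^esub> v = - v"
    using assms herm_uminus
    by (intro abelian_group.minus_equality[OF X.abelian_group_axioms]) (auto simp: mat_sa_space_simps)
  then show ?thesis
    using herm_carrier[OF assms(2)] herm_carrier[OF assms(3)]
    by (intro eq_matI) (auto simp: a_minus_def mat_sa_space_simps)
qed

lemma pos_herm: "1 \<le> n \<Longrightarrow> v \<in> pos n \<Longrightarrow> v \<in> herm n"
  using real_ordered_space.P_subset[OF ordered] by (auto simp: mat_sa_space_simps)

lemma pos_carrier: "1 \<le> n \<Longrightarrow> v \<in> pos n \<Longrightarrow> v \<in> carrier_mat n n"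
  using pos_herm herm_carrier by blast

lemma pos_add: "1 \<le> n \<Longrightarrow> u \<in> pos n \<Longrightarrow> v \<in> pos n \<Longrightarrow> u + v \<in> pos n"
  using real_ordered_space.P_add[OF ordered] by (auto simp: mat_sa_space_simps)

lemma pos_scale: "1 \<le> n \<Longrightarrow> 0 \<le> k \<Longrightarrow> v \<in> pos n \<Longrightarrow> map_mat (scale (of_real k)) v \<in> pos n"
  using real_ordered_space.P_smult[OF ordered] by (auto simp: mat_sa_space_simps)

text \<open>The cone is non-empty, and scaling one of its elements by 0 gives the zero
  matrix.\<close>

lemma zero_pos: "1 \<le> n \<Longrightarrow> 0\<^sub>m n n \<in> pos n"
proof -
  assume n: "1 \<le> n"
  obtain p where p: "p \<in> pos n" using real_ordered_space.P_nonempty[OF ordered[OF n]] by blast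
  have "map_mat (scale (of_real 0)) p = 0\<^sub>m n n"
    using pos_carrier[OF n p] by (intro eq_matI) auto
  then show ?thesis using pos_scale[OF n _ p, of 0] by simp
qed

lemma herm_diff: "u \<in> herm n \<Longrightarrow> v \<in> herm n \<Longrightarrow> u - v \<in> herm n"
  using herm_add[OF _ herm_uminus, of u n v] herm_carrier[of u n] herm_carrier[of v n]
  by (simp add: minus_add_uminus_mat)

section \<open>The modulus on square matrices\<close>

lemma md_carrier: "1 \<le> m \<Longrightarrow> 1 \<le> n \<Longrightarrow> v \<in> carrier_mat m n \<Longrightarrow> md m n v \<in> carrier_mat n n"
  using md_pos pos_carrier by blast

lemma md_of_pos: "1 \<le> n \<Longrightarrow> v \<in> pos n \<Longrightarrow> md n n v = v"
  using absolutely_ordered_space.md_of_pos[OF absolutely_ordered] by blast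

lemma md_plus: "1 \<le> n \<Longrightarrow> v \<in> herm n \<Longrightarrow> md n n v + v \<in> pos n"
  using absolutely_ordered_space.md_plus[OF absolutely_ordered] by (simp add: mat_sa_space_simps)

text \<open>Homogeneity of the modulus at the scalar -1.\<close>

lemma md_uminus: "1 \<le> n \<Longrightarrow> v \<in> herm n \<Longrightarrow> md n n (- v) = md n n v"
proof -
  assume n: "1 \<le> n" and v: "v \<in> herm n"
  have c: "map_mat (scale (of_real 1)) A = A" for A by (intro eq_matI) auto
  have "map_mat (scale (of_real (- 1))) v = - v" by (intro eq_matI) auto
  then show ?thesis
    using absolutely_ordered_space.md_smult[OF absolutely_ordered[OF n], of v "- 1"] v c
    by (simp add: mat_sa_space_simps)
qed

lemma md_orth_le:
  assumes "1 \<le> n" "u \<in> pos n" "v \<in> pos n" "w \<in> pos n" "md n n (u - v) = u + v" "v - w \<in> pos n"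
  shows "md n n (u - w) = u + w"
  using absolutely_ordered_space.md_orth_le[OF absolutely_ordered, of n u v w] assms
  by (simp add: mat_sa_space_simps mat_sa_space_minus pos_herm)

lemma md_orth_md_add:
  assumes "1 \<le> n" "u \<in> pos n" "v \<in> pos n" "w \<in> pos n"
    and "md n n (u - v) = u + v" "md n n (u - w) = u + w"
  shows "md n n (u - md n n (v + w)) = u + md n n (v + w)"
proof -
  have "md n n (v + w) \<in> herm n"
    using assms by (intro pos_herm md_pos herm_carrier[OF herm_add]) auto
  then show ?thesis
    using absolutely_ordered_space.md_orth_md_add[OF absolutely_ordered, of n u v w] assms
    by (simp add: mat_sa_space_simps mat_sa_space_minus pos_herm)
qed

lemma md_orth_md_diff:
  assumes "1 \<le> n" "u \<in> pos n" "v \<in> pos n" "w \<in> pos n"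
    and "md n n (u - v) = u + v" "md n n (u - w) = u + w"
  shows "md n n (u - md n n (v - w)) = u + md n n (v - w)"
proof -
  have "md n n (v - w) \<in> herm n"
    using assms by (intro pos_herm md_pos herm_carrier[OF herm_diff]) auto
  then show ?thesis
    using absolutely_ordered_space.md_orth_md_diff[OF absolutely_ordered, of n u v w] assms
    by (simp add: mat_sa_space_simps mat_sa_space_minus pos_herm)
qed

text \<open>A modulus forces the cone to be proper: if \<open>d\<close> and \<open>- d\<close> are positive,
  then \<open>d = \<bar>d\<bar> = \<bar>- d\<bar> = - d\<close>.\<close>

lemma pos_antisym:
  assumes n: "1 \<le> n" and uv: "u \<in> herm n" "v \<in> herm n" and le: "u - v \<in> pos n" "v - u \<in> pos n"
  shows "u = v"
proof -
  let ?d = "u - v"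
  note c = herm_carrier[OF uv(1)] herm_carrier[OF uv(2)]
  have "v - u = - ?d" using c by (intro eq_matI) auto
  then have "- ?d = ?d"
    using md_uminus[OF n herm_diff[OF uv]] md_of_pos[OF n le(1)] md_of_pos[OF n le(2)] by simp
  show ?thesis
  proof (rule eq_matI)
    fix i j assume "i < dim_row v" "j < dim_col v"
    then have ij: "i < n" "j < n" using c by auto
    have "(- ?d) $$ (i, j) = ?d $$ (i, j)" using \<open>- ?d = ?d\<close> by simp
    then have "(u $$ (i, j) - v $$ (i, j)) + (u $$ (i, j) - v $$ (i, j)) = 0"
      using c ij by (simp add: algebra_simps)
    \<comment> \<open>A vector \<open>x\<close> with \<open>x + x = 0\<close> vanishes because the
      scalar 2 is invertible.\<close>
    then have "scale (1 + 1) (u $$ (i, j) - v $$ (i, j)) = 0"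
      by (simp only: scale_left_distrib scale_one)
    then show "u $$ (i, j) = v $$ (i, j)" by (simp add: scale_eq_0_iff)
  qed (use c in auto)
qed

section \<open>Permutations of rows and columns\<close>

definition permute_rows :: "nat \<Rightarrow> (nat \<Rightarrow> nat) \<Rightarrow> 'v mat \<Rightarrow> 'v mat" where
  "permute_rows n \<sigma> v = mat n n (\<lambda>(i, j). v $$ (\<sigma> i, j))"

text \<open>With \<open>Q\<close> for \<open>perm_mat n \<sigma>\<close>, this is the conjugate of
  \<open>v\<close> by \<open>Q\<close>, while \<open>permute_rows n \<sigma> v\<close> is
  \<open>Q v\<close>.\<close>

definition permute_both :: "nat \<Rightarrow> (nat \<Rightarrow> nat) \<Rightarrow> 'v mat \<Rightarrow> 'v mat" where
  "permute_both n \<sigma> v = mat n n (\<lambda>(i, j). v $$ (\<sigma> i, \<sigma> j))"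

lemma permutes_less: "\<sigma> permutes {..<n} \<Longrightarrow> \<sigma> i < n \<longleftrightarrow> i < n"
  using permutes_in_image[of \<sigma> "{..<n}" i] by simp

lemma scale_if: "scale (if b then 1 else 0) x = (if b then x else 0)"
  by simp

lemma lmult_perm_mat:
  assumes "\<sigma> permutes {..<n}" "v \<in> carrier_mat n n"
  shows "lmult (perm_mat n \<sigma>) v = permute_rows n \<sigma> v"
proof (rule eq_matI)
  fix i j assume "i < dim_row (permute_rows n \<sigma> v)" "j < dim_col (permute_rows n \<sigma> v)"
  then have ij: "i < n" "j < n" by (auto simp: permute_rows_def)
  have "lmult (perm_mat n \<sigma>) v $$ (i, j) = (\<Sum>k<n. if k = \<sigma> i then v $$ (\<sigma> i, j) else 0)"
    using ij assms by (simp add: mprod_def perm_mat_def scale_if permutes_less)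
  then show "lmult (perm_mat n \<sigma>) v $$ (i, j) = permute_rows n \<sigma> v $$ (i, j)"
    using ij permutes_less[OF assms(1)] by (simp add: permute_rows_def)
qed (use assms in \<open>auto simp: mprod_def permute_rows_def perm_mat_def\<close>)

lemma rmult_adjoint_perm_mat:
  assumes "\<sigma> permutes {..<n}" "v \<in> carrier_mat n n"
  shows "rmult v (mat_adjoint (perm_mat n \<sigma>)) = mat n n (\<lambda>(i, j). v $$ (i, \<sigma> j))"
proof (rule eq_matI, goal_cases)
  case (1 i j)
  then have ij: "i < n" "j < n" by auto
  have "rmult v (mat_adjoint (perm_mat n \<sigma>)) $$ (i, j) = (\<Sum>k<n. if k = \<sigma> j then v $$ (i, \<sigma> j) else 0)"
    using ij assms
    by (simp add: mprod_def perm_mat_def mat_adjoint_index if_distrib[of cnj] scale_if permutes_less cong: if_cong)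
  then show ?case
    using ij permutes_less[OF assms(1)] by simp
qed (use assms in \<open>auto simp: mprod_def perm_mat_def\<close>)

lemma adjoint_perm_mat_carrier: "mat_adjoint (perm_mat n \<sigma>) \<in> carrier_mat n n"
  by (rule carrier_matI) (auto simp: perm_mat_def)

lemma adjoint_adjoint_perm_mat: "mat_adjoint (mat_adjoint (perm_mat n \<sigma>)) = perm_mat n \<sigma>"
  by (rule eq_matI) (auto simp: mat_adjoint_index perm_mat_def)

lemma permute_rows_carrier [simp]: "permute_rows n \<sigma> v \<in> carrier_mat n n"
  by (simp add: permute_rows_def)

lemma permute_both_carrier [simp]: "permute_both n \<sigma> v \<in> carrier_mat n n"
  by (simp add: permute_both_def)

lemma perm_mat_conj:
  assumes "\<sigma> permutes {..<n}" "v \<in> carrier_mat n n"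
  shows "rmult (lmult (perm_mat n \<sigma>) v) (mat_adjoint (perm_mat n \<sigma>)) = permute_both n \<sigma> v"
  unfolding lmult_perm_mat[OF assms] rmult_adjoint_perm_mat[OF assms(1) permute_rows_carrier]
  by (rule eq_matI) (auto simp: permute_rows_def permute_both_def permutes_less[OF assms(1)])

text \<open>The conjugation axiom for cones, applied to the adjoint of the permutation
  matrix.\<close>

lemma permute_both_pos:
  assumes "1 \<le> n" "\<sigma> permutes {..<n}" "v \<in> pos n"
  shows "permute_both n \<sigma> v \<in> pos n"
  using pos_conj[of n n v "mat_adjoint (perm_mat n \<sigma>)"] assms adjoint_perm_mat_carrier
    perm_mat_conj[OF assms(2) pos_carrier[OF assms(1,3)]]
  by (simp add: adjoint_adjoint_perm_mat)

lemma scale_le: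
  assumes "1 \<le> n" "k \<le> l" "v \<in> pos n"
  shows "map_mat (scale (of_real l)) v - map_mat (scale (of_real k)) v \<in> pos n"
proof -
  have "map_mat (scale (of_real l)) v - map_mat (scale (of_real k)) v = map_mat (scale (of_real (l - k))) v"
    by (rule eq_matI) (auto simp: scale_left_diff_distrib)
  then show ?thesis using pos_scale[OF assms(1) _ assms(3), of "l - k"] assms(2) by simp
qed

lemma pos_trans:
  assumes "1 \<le> n" "v - u \<in> pos n" "w - v \<in> pos n"
    and "u \<in> carrier_mat n n" "v \<in> carrier_mat n n" "w \<in> carrier_mat n n"
  shows "w - u \<in> pos n"
proof -
  have "w - u = (w - v) + (v - u)"
    using assms(4-6) by (intro eq_matI) auto
  then show ?thesis using pos_add assms by simp
qed

text \<open>The multiplication axiom with an upper bound \<open>k\<close> in place of the norm: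
  positive elements grow with a real scalar factor. It is used where norms are known only through
  inequalities.\<close>

lemma md_mult_le:
  assumes n: "1 \<le> n" and v: "v \<in> carrier_mat n n" and a: "a \<in> carrier_mat n n"
    and b: "b \<in> carrier_mat n n" and k: "mnorm a \<le> k"
  shows "map_mat (scale (of_real k)) (md n n (rmult (md n n v) b)) - md n n (rmult (lmult a v) b) \<in> pos n"
proof -
  have c: "rmult (md n n v) b \<in> carrier_mat n n" "rmult (lmult a v) b \<in> carrier_mat n n"
    using md_carrier[OF n n v] a b by (auto simp: mprod_def)
  show ?thesis
    by (rule pos_trans[OF n md_mult[OF n n n n v a b] scale_le[OF n k md_pos[OF n n c(1)]]])
      (use md_carrier[OF n n c(1)] md_carrier[OF n n c(2)] in auto)
qed

lemma rmult_one: "v \<in> carrier_mat m n \<Longrightarrow> rmult v (1\<^sub>m n) = v"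
proof (rule eq_matI, goal_cases)
  case (1 i j)
  then have "rmult v (1\<^sub>m n) $$ (i, j) = (\<Sum>k<n. if k = j then v $$ (i, j) else 0)"
    by (auto simp: mprod_def scale_if)
  then show ?case using 1 by auto
qed (auto simp: mprod_def)

lemma scale_mat_one: "map_mat (scale (of_real 1)) v = v"
  by (rule eq_matI) auto

text \<open>The multiplication axiom with a permutation matrix on the left, of norm at most 1, and
  the identity on the right; the outer modulus disappears because \<open>md n n v\<close> is
  positive.\<close>

lemma md_permute_rows_le:
  assumes n: "1 \<le> n" and \<sigma>: "\<sigma> permutes {..<n}" and v: "v \<in> carrier_mat n n"
  shows "md n n v - md n n (permute_rows n \<sigma> v) \<in> pos n"
  using md_mult_le[OF n v perm_mat_carrier one_carrier_mat mnorm_perm_mat_le_1[OF \<sigma>]]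
    rmult_one[OF md_carrier[OF n n v]] rmult_one[OF permute_rows_carrier, of n \<sigma> v]
    md_of_pos[OF n md_pos[OF n n v]]
  by (simp add: lmult_perm_mat[OF \<sigma> v] scale_mat_one del: of_real_1)

text \<open>Writing \<open>Q\<close> for the permutation matrix, \<open>\<bar>v\<bar> Q\<^sup>* = Q\<^sup>* (Q \<bar>v\<bar> Q\<^sup>*)\<close>, so
  \<open>\<bar>Q v Q\<^sup>*\<bar> \<le> \<bar>\<bar>v\<bar> Q\<^sup>*\<bar> \<le> \<bar>Q \<bar>v\<bar> Q\<^sup>*\<bar> = Q \<bar>v\<bar> Q\<^sup>*\<close>.\<close>

lemma md_permute_both_le:
  assumes n: "1 \<le> n" and \<sigma>: "\<sigma> permutes {..<n}" and v: "v \<in> carrier_mat n n"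
  shows "permute_both n \<sigma> (md n n v) - md n n (permute_both n \<sigma> v) \<in> pos n"
proof -
  note mdv = md_carrier[OF n n v]
  let ?Q' = "mat_adjoint (perm_mat n \<sigma>)"
  let ?r = "rmult (md n n v) ?Q'"
  have r: "?r \<in> carrier_mat n n"
    using mdv by (auto simp: mprod_def perm_mat_def)
  have 1: "md n n ?r - md n n (permute_both n \<sigma> v) \<in> pos n"
    using md_mult_le[OF n v perm_mat_carrier adjoint_perm_mat_carrier[of n \<sigma>] mnorm_perm_mat_le_1[OF \<sigma>]]
    by (simp add: scale_mat_one perm_mat_conj[OF \<sigma> v] del: of_real_1)
  \<comment> \<open>The adjoint of \<open>Q\<close> is the permutation matrix of the inverse of
    \<sigma>. It undoes the permutation of the rows and leaves that of the columns.\<close>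
  have "permute_rows n (Hilbert_Choice.inv \<sigma>) (permute_both n \<sigma> (md n n v)) = ?r"
    using permutes_less[OF permutes_inv[OF \<sigma>]] permutes_inverses[OF \<sigma>] mdv
    unfolding rmult_adjoint_perm_mat[OF \<sigma> mdv] permute_rows_def permute_both_def
    by (intro eq_matI) simp_all
  then have 2: "permute_both n \<sigma> (md n n v) - md n n ?r \<in> pos n"
    using md_permute_rows_le[OF n permutes_inv[OF \<sigma>] permute_both_carrier]
      md_of_pos[OF n permute_both_pos[OF n \<sigma> md_pos[OF n n v]]]
    by metis
  show ?thesis
    by (rule pos_trans[OF n 1 2]) (use md_carrier[OF n n] r in auto)
qed

lemma permute_both_inv:
  assumes "\<sigma> permutes {..<n}" "v \<in> carrier_mat n n"
  shows "permute_both n \<sigma> (permute_both n (Hilbert_Choice.inv \<sigma>) v) = v"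
    and "permute_both n (Hilbert_Choice.inv \<sigma>) (permute_both n \<sigma> v) = v"
  using assms permutes_less[OF assms(1)] permutes_less[OF permutes_inv[OF assms(1)]]
    permutes_inverses[OF assms(1)]
  by (intro eq_matI; simp add: permute_both_def carrier_matD)+

lemma permute_both_diff:
  assumes "\<sigma> permutes {..<n}" "u \<in> carrier_mat n n" "v \<in> carrier_mat n n"
  shows "permute_both n \<sigma> (u - v) = permute_both n \<sigma> u - permute_both n \<sigma> v"
  using assms permutes_less[OF assms(1)] by (intro eq_matI) (simp_all add: permute_both_def)

lemma permute_both_add:
  assumes "\<sigma> permutes {..<n}" "u \<in> carrier_mat n n" "v \<in> carrier_mat n n"
  shows "permute_both n \<sigma> (u + v) = permute_both n \<sigma> u + permute_both n \<sigma> v"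
  using assms permutes_less[OF assms(1)] by (intro eq_matI) (simp_all add: permute_both_def)

text \<open>Conjugation by \<sigma> is invertible and preserves positivity. The preceding inequality
  for the inverse permutation and the permuted matrix, conjugated back by \<sigma>, is the reverse
  inequality; the cone is proper.\<close>

lemma md_permute_both:
  assumes n: "1 \<le> n" and \<sigma>: "\<sigma> permutes {..<n}" and v: "v \<in> carrier_mat n n"
  shows "md n n (permute_both n \<sigma> v) = permute_both n \<sigma> (md n n v)"
proof (rule pos_antisym[OF n])
  let ?y = "permute_both n \<sigma> v"
  note \<tau> = permutes_inv[OF \<sigma>]
  have "permute_both n (Hilbert_Choice.inv \<sigma>) (md n n ?y) - md n n v \<in> pos n"
    using md_permute_both_le[OF n \<tau>, of ?y] by (simp add: permute_both_inv[OF \<sigma> v])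
  from permute_both_pos[OF n \<sigma> this]
  show "md n n ?y - permute_both n \<sigma> (md n n v) \<in> pos n"
    by (simp add: permute_both_diff[OF \<sigma>] md_carrier[OF n n] v permute_both_inv[OF \<sigma>])
  show "permute_both n \<sigma> (md n n v) - md n n ?y \<in> pos n"
    by (rule md_permute_both_le[OF n \<sigma> v])
  show "md n n ?y \<in> herm n" "permute_both n \<sigma> (md n n v) \<in> herm n"
    using pos_herm[OF n] md_pos[OF n n] permute_both_pos[OF n \<sigma>] v by auto
qed

section \<open>Moduli of block matrices\<close>

lemma md_zero: "1 \<le> n \<Longrightarrow> md n n (0\<^sub>m n n) = 0\<^sub>m n n"
  using md_of_pos zero_pos by blast

text \<open>The block axiom for all three moduli, together with \<open>|0| = 0\<close>, splits
  \<open>|u| \<oplus> |v|\<close> into its two diagonal parts. This is additivity for independent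
  elements in block diagonal position.\<close>

lemma md_diag_block_add:
  assumes "1 \<le> m" "1 \<le> n" "u \<in> carrier_mat m m" "v \<in> carrier_mat n n"
  shows "md (m + n) (m + n) (diag_block_mat [u, v]) =
    md (m + n) (m + n) (diag_block_mat [u, 0\<^sub>m n n]) + md (m + n) (m + n) (diag_block_mat [0\<^sub>m m m, v])"
proof -
  note c = md_carrier[OF assms(1,1,3)] md_carrier[OF assms(2,2,4)]
  have "diag_block_mat [md m m u, md n n v] =
      diag_block_mat [md m m u, 0\<^sub>m n n] + diag_block_mat [0\<^sub>m m m, md n n v]"
    using c by (intro eq_matI) (auto simp: Let_def)
  then show ?thesis using assms by (simp add: md_block md_zero del: diag_block_mat.simps)
qed

text \<open>The matrix with blocks \<open>\<bar>v\<^sup>*\<bar>, v, v\<^sup>*, \<bar>v\<bar>\<close> is positive because the off-diagonal part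
  arises from \<open>v\<^sup>* \<oplus> v\<close> by a permutation of the rows, so that its modulus is at most
  \<open>\<bar>v\<^sup>*\<bar> \<oplus> \<bar>v\<bar>\<close>.\<close>

lemma md_block_sa_pos:
  assumes n: "1 \<le> n" and v: "v \<in> carrier_mat n n"
  shows "diag_block_mat [md n n (mstar star v), md n n v] +
    mat (n + n) (n + n) (\<lambda>(i, j). if i < n \<and> n \<le> j then v $$ (i, j - n)
      else if n \<le> i \<and> j < n then star (v $$ (j, i - n)) else 0) \<in> pos (n + n)"
    (is "?D + ?W \<in> _")
proof -
  let ?X = "diag_block_mat [mstar star v, v]"
  \<comment> \<open>The involution that swaps the two halves of the indices: the upper rows of
    \<open>?X\<close> become its lower ones and conversely, so both diagonal blocks move off the
    diagonal.\<close>
  define \<sigma> where "\<sigma> i = (if i < n then i + n else if i < n + n then i - n else i)" for i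
  have s: "mstar star v \<in> carrier_mat n n" using v by auto
  have n2: "1 \<le> n + n" using n by simp
  have X: "?X \<in> carrier_mat (n + n) (n + n)" by (rule diag_block_mat_carrier[OF s v])
  have "\<sigma> permutes {..<n + n}"
    by (rule bij_imp_permutes, rule bij_betw_byWitness[of _ \<sigma>]) (auto simp: \<sigma>_def)
  moreover have "permute_rows (n + n) \<sigma> ?X = ?W"
  proof (rule eq_matI, goal_cases)
    case (1 i j)
    then show ?case
      using v by (auto simp: permute_rows_def \<sigma>_def diag_block_mat_index[OF s v] simp del: diag_block_mat.simps)
  qed (auto simp: permute_rows_def)
  moreover have "md (n + n) (n + n) ?X = ?D" by (rule md_block[OF n n n n s v])
  ultimately have le: "?D - md (n + n) (n + n) ?W \<in> pos (n + n)"
    using md_permute_rows_le[OF n2 _ X] by metis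
  have W: "?W \<in> herm (n + n)" by (auto simp: herm_iff star_star star_zero)
  have D: "?D \<in> carrier_mat (n + n) (n + n)"
    by (rule diag_block_mat_carrier) (use md_carrier[OF n n] s v in auto)
  \<comment> \<open>The first summand is positive by the row permutation, the second because
    \<open>|W| + W\<close> is positive for self-adjoint \<open>W\<close>.\<close>
  have "?D + ?W = (?D - md (n + n) (n + n) ?W) + (md (n + n) (n + n) ?W + ?W)"
    using D md_carrier[OF n2 n2 herm_carrier[OF W]]
    by (intro eq_matI) (auto simp del: diag_block_mat.simps)
  then show ?thesis using pos_add[OF n2 le md_plus[OF n2 W]] by simp
qed

section \<open>The cone and the modulus of the inductive limit\<close>

lemma fadjoint_entry: "entry (fadjoint a) i j = cnj (entry a j i)"
  by (simp add: entry_fstar)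

lemma corner_fadjoint: "corner n (fadjoint a) = mat_adjoint (corner n a)"
  by (rule eq_matI) (auto simp: fadjoint_entry mat_adjoint_index)

lemma limT_in_lim_pos: "1 \<le> n \<Longrightarrow> p \<in> pos n \<Longrightarrow> limT n p \<in> lim_pos pos"
  unfolding lim_pos_def by auto

text \<open>The size at which positivity of \<open>v\<close> is witnessed is unrelated to
  \<open>N\<close>. Conjugation by a rectangular matrix handles both cases, truncating if
  \<open>N < n\<close> and padding with zeros if \<open>N > n\<close>.\<close>

lemma corner_pos:
  assumes N: "1 \<le> N" and v: "v \<in> lim_pos pos"
  shows "corner N v \<in> pos N"
proof -
  obtain n p where n: "1 \<le> n" "p \<in> pos n" "v = limT n p"
    using v unfolding lim_pos_def by auto
  \<comment> \<open>The rectangular matrix with ones on its diagonal and zeros elsewhere.\<close>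
  define E where "E = mat n N (\<lambda>(i, j). if i = j then 1 else 0 :: complex)"
  have E: "E \<in> carrier_mat n N" "dim_row E = n" "dim_col E = N" by (auto simp: E_def)
  note p = pos_carrier[OF n(1,2)]
  have l: "lmult (mat_adjoint E) p = mat N n (\<lambda>(i, j). if i < n then p $$ (i, j) else 0)"
  proof (rule eq_matI, goal_cases)
    case (1 i j)
    then have ij: "i < N" "j < n" by auto
    have "lmult (mat_adjoint E) p $$ (i, j) = (\<Sum>k<n. if k = i then p $$ (i, j) else 0)"
      using ij E p by (simp add: mprod_def mat_adjoint_index E_def if_distrib[of cnj] scale_if cong: if_cong)
    then show ?case using ij by auto
  qed (use E p in \<open>auto simp: mprod_def\<close>)
  have "rmult (lmult (mat_adjoint E) p) E = corner N v"
  proof (rule eq_matI, goal_cases)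
    case (1 i j)
    then have ij: "i < N" "j < N" by auto
    have "rmult (lmult (mat_adjoint E) p) E $$ (i, j) =
        (\<Sum>k<n. if k = j then if i < n then p $$ (i, j) else 0 else 0)"
      unfolding l using ij by (simp add: mprod_def E_def scale_if)
    then show ?case using ij n by (auto simp: limT.rep_eq)
  qed (use E in \<open>auto simp: mprod_def\<close>)
  then show ?thesis using pos_conj[OF N n(1,2) E(1)] by simp
qed

text \<open>Positivity in the limit can be tested at any size that contains the support.\<close>

lemma lim_pos_iff:
  assumes "1 \<le> N" "supported {..<N} v"
  shows "v \<in> lim_pos pos \<longleftrightarrow> corner N v \<in> pos N"
  using corner_pos[OF assms(1)] limT_in_lim_pos[OF assms(1)] limT_corner[OF assms(2)] by metis

text \<open>The order is the least admissible size, so the corner of size \<open>N\<close> is the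
  one at the order padded with zeros, and the block axiom with \<open>|0| = 0\<close> says that the
  modulus is padded in the same way.\<close>

lemma lim_md_eq:
  assumes N: "1 \<le> N" and v: "supported {..<N} v"
  shows "lim_md scale md v = limT N (md N N (corner N v))"
proof -
  let ?n = "lim_order scale v"
  note n = lim_order_props[of v]
  have md: "lim_md scale md v = limT ?n (md ?n ?n (corner ?n v))"
    unfolding lim_md_def Let_def by (simp add: limT_inv_eq n)
  show ?thesis
  proof (cases "?n = N")
    \<comment> \<open>The block axiom speaks only of blocks of size at least 1, so equality of the
      sizes is a separate case.\<close>
    case False
    define r where "r = N - ?n"
    have r: "1 \<le> r" "N = ?n + r" using False lim_order_le[OF N v] by (auto simp: r_def)
    have "corner N v = diag_block_mat [corner ?n v, 0\<^sub>m r r]"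
      using r supportedD[OF n(2)] by (intro eq_matI) (auto simp: Let_def)
    then have "md N N (corner N v) = diag_block_mat [md ?n ?n (corner ?n v), 0\<^sub>m r r]"
      using md_block[OF n(1) n(1) r(1) r(1) corner_carrier zero_carrier_mat] r
      by (simp add: md_zero del: diag_block_mat.simps)
    then show ?thesis
      unfolding md using r md_carrier[OF n(1) n(1) corner_carrier, of v]
      by (intro fmat_eqI) (auto simp: limT.rep_eq diag_block_mat_index[of _ ?n ?n _ r r] simp del: diag_block_mat.simps)
  qed (use md in simp)
qed

lemma corner_lim_md:
  assumes N: "1 \<le> N" and v: "supported {..<N} v"
  shows "corner N (lim_md scale md v) = md N N (corner N v)"
  unfolding lim_md_eq[OF N v] by (rule corner_limT[OF md_carrier[OF N N corner_carrier]])

lemma supported_lim_md: "1 \<le> N \<Longrightarrow> supported {..<N} v \<Longrightarrow> supported {..<N} (lim_md scale md v)"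
  by (simp add: lim_md_eq supported_limT)

lemma fmat_eq_iff_corner:
  assumes "supported {..<N} u" "supported {..<N} v"
  shows "u = v \<longleftrightarrow> corner N u = corner N v"
  using limT_corner assms by metis

section \<open>Additivity on independent elements\<close>

lemma lim_md_add:
  assumes fin: "finite I" "finite J" and disj: "I \<inter> J = {}" and u: "supported I u" and v: "supported J v"
  shows "lim_md scale md (u + v) = lim_md scale md u + lim_md scale md v"
proof -
  obtain M where M: "I \<union> J \<subseteq> {..<M}"
    using fin finite_nat_iff_bounded[of "I \<union> J"] by blast
  \<comment> \<open>The two extra indices make both diagonal blocks non-empty.\<close>
  define N where "N = M + 2"
  define K where "K = insert M I"
  define p r where "p = card K" and "r = N - p"
  have K: "K \<subseteq> {..<N}" "finite K" using M fin by (auto simp: K_def N_def)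
  \<comment> \<open>The index \<open>M + 1\<close> stays outside \<open>K\<close>, whence
    \<open>r\<close> is at least 1; the index \<open>M\<close> in \<open>K\<close> gives the same
    for \<open>p\<close>.\<close>
  have "K \<subseteq> {..<M + 1}" using M by (auto simp: K_def)
  then have "p \<le> M + 1" unfolding p_def using card_mono[of "{..<M + 1}" K] by simp
  moreover have "1 \<le> p" using K by (simp add: p_def K_def card_gt_0_iff Suc_le_eq)
  ultimately have p: "1 \<le> p" "1 \<le> r" "N = p + r" "1 \<le> N" by (auto simp: r_def N_def)
  obtain \<sigma> where \<sigma>: "\<sigma> permutes {..<N}" "\<And>i. i < N \<Longrightarrow> \<sigma> i \<in> K \<longleftrightarrow> i < p"
    using ex_permutes_image_lessThan[OF K(1)] unfolding p_def by metis
  have JK: "K \<inter> J = {}" using disj M by (auto simp: K_def)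
  have suppu: "entry u i j = 0" if "i \<notin> K \<or> j \<notin> K" for i j
    using supportedD[OF u] that by (auto simp: K_def)
  have suppv: "entry v i j = 0" if "i \<in> K \<or> j \<in> K" for i j
    by (rule supportedD[OF v]) (use that JK in blast)
  have uN: "supported {..<N} u" and vN: "supported {..<N} v"
    by (rule supported_mono[OF u], use M in \<open>force simp: N_def\<close>)
      (rule supported_mono[OF v], use M in \<open>force simp: N_def\<close>)
  note \<sigma>less = permutes_less[OF \<sigma>(1)]
  \<comment> \<open>After the permutation the entries of \<open>u\<close> fill only the first
    diagonal block and those of \<open>v\<close> only the second.\<close>
  define A where "A = mat p p (\<lambda>(i, j). entry u (\<sigma> i) (\<sigma> j))"
  define B where "B = mat r r (\<lambda>(i, j). entry v (\<sigma> (i + p)) (\<sigma> (j + p)))"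
  have A: "A \<in> carrier_mat p p" and B: "B \<in> carrier_mat r r" by (auto simp: A_def B_def)
  have pc: "permute_both N \<sigma> x \<in> carrier_mat (p + r) (p + r)" for x
    using permute_both_carrier p(3) by metis
  have pe: "permute_both N \<sigma> (corner N x) $$ (i, j) = entry x (\<sigma> i) (\<sigma> j)"
    if "i < p + r" "j < p + r" for x i j
    using that \<sigma>less p(3) by (simp add: permute_both_def)
  have \<sigma>K: "\<sigma> i \<in> K \<longleftrightarrow> i < p" if "i < p + r" for i
    using \<sigma>(2) that p(3) by simp
  have cu: "permute_both N \<sigma> (corner N u) = diag_block_mat [A, 0\<^sub>m r r]"
    by (rule eq_diag_block_matI[OF A zero_carrier_mat pc])
      (use \<sigma>K suppu in \<open>auto simp: pe A_def\<close>)
  have cv: "permute_both N \<sigma> (corner N v) = diag_block_mat [0\<^sub>m p p, B]"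
    by (rule eq_diag_block_matI[OF zero_carrier_mat B pc])
      (use \<sigma>K suppv in \<open>auto simp: pe B_def\<close>)
  have cuv: "permute_both N \<sigma> (corner N (u + v)) = diag_block_mat [A, B]"
  proof -
    have "diag_block_mat [A, 0\<^sub>m r r] + diag_block_mat [0\<^sub>m p p, B] = diag_block_mat [A, B]"
      using A B by (intro eq_matI) (auto simp: Let_def)
    then show ?thesis
      by (simp only: corner_add permute_both_add[OF \<sigma>(1) corner_carrier corner_carrier] cu cv)
  qed
  let ?md = "md N N"
  note mdp = md_permute_both[OF p(4) \<sigma>(1) corner_carrier]
  have "permute_both N \<sigma> (?md (corner N (u + v))) =
      permute_both N \<sigma> (?md (corner N u)) + permute_both N \<sigma> (?md (corner N v))"
    unfolding mdp[symmetric] cu cv cuv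
    using md_diag_block_add[OF p(1,2) A B] unfolding p(3)[symmetric] .
  also have "\<dots> = permute_both N \<sigma> (?md (corner N u) + ?md (corner N v))"
    by (intro permute_both_add[symmetric] \<sigma>(1) md_carrier p corner_carrier)
  \<comment> \<open>The inverse permutation is applied to both sides.\<close>
  finally have "?md (corner N (u + v)) = ?md (corner N u) + ?md (corner N v)"
    using permute_both_inv(2)[OF \<sigma>(1)] md_carrier[OF p(4,4) corner_carrier] add_carrier_mat by metis
  then show ?thesis
    unfolding lim_md_eq[OF p(4) uN] lim_md_eq[OF p(4) vN] lim_md_eq[OF p(4) supported_add[OF uN vN]]
    using limT_add[OF md_carrier[OF p(4,4) corner_carrier] md_carrier[OF p(4,4) corner_carrier]] by metis
qed

lemma lim_pos_add: "u \<in> lim_pos pos \<Longrightarrow> v \<in> lim_pos pos \<Longrightarrow> u + v \<in> lim_pos pos"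
proof -
  assume u: "u \<in> lim_pos pos" and v: "v \<in> lim_pos pos"
  obtain N where N: "1 \<le> N" "supported {..<N} u" "supported {..<N} v" using ex_supported3 by metis
  show ?thesis
    using pos_add[OF N(1) corner_pos[OF N(1) u] corner_pos[OF N(1) v]]
    by (simp add: lim_pos_iff[OF N(1) supported_add[OF N(2,3)]] corner_add)
qed

section \<open>The limit as an ordered bimodule\<close>

lemma ordered_F_bimodule_lim:
  "ordered_F_bimodule (lim_lact scale) (lim_ract scale) (fstar star) (lim_pos pos)"
proof
  fix a :: "complex fmat" and u v :: "'v fmat"
  obtain N where N: "1 \<le> N" "supported {..<N} a" "supported {..<N} v" using ex_supported3 by metis
  note N' = supported_fstar[OF N(2), of cnj]
  have star_sum: "star (sum f {..<n}) = (\<Sum>k<n. star (f k))" for f and n :: nat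
    by (induction n) (auto simp: star_add star_zero)
  note e = entry_lact[of N] entry_ract[of N] N N' entry_fstar[of star] star_zero entry_fstar[of cnj]
    star_sum star_scale plus_fmat.rep_eq star_add star_star
  show "fstar star (u + v) = fstar star u + fstar star v"
    by (rule fmat_eqI) (simp add: e)
  show "fstar star (a \<triangleright> v) = fstar star v \<triangleleft> fadjoint a"
    by (rule fmat_eqI) (simp add: e)
  show "fstar star (v \<triangleleft> a) = fadjoint a \<triangleright> fstar star v"
    by (rule fmat_eqI) (simp add: e)
  show "fstar star (fstar star v) = v"
    by (rule fmat_eqI) (simp add: e)
  show "u + v \<in> lim_pos pos" if "u \<in> lim_pos pos" "v \<in> lim_pos pos"
    using lim_pos_add that .
  show "fstar star v = v" if "v \<in> lim_pos pos"
  proof (rule fmat_eqI)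
    fix i j
    show "entry (fstar star v) i j = entry v i j"
    proof (cases "i < N \<and> j < N")
      case True
      have "corner N v \<in> herm N" by (rule pos_herm[OF N(1) corner_pos[OF N(1) that]])
      then show ?thesis using True by (auto simp: herm_iff e)
    qed (use supportedD[OF N(3)] in \<open>auto simp: e\<close>)
  qed
  show "fadjoint a \<triangleright> v \<triangleleft> a \<in> lim_pos pos" if "v \<in> lim_pos pos"
  proof -
    have l: "supported {..<N} (fadjoint a \<triangleright> v)" by (rule supported_lact[OF N' N(3)])
    have "corner N (fadjoint a \<triangleright> v \<triangleleft> a) =
        rmult (lmult (mat_adjoint (corner N a)) (corner N v)) (corner N a)"
      using l N N' by (simp add: mprod_corner_lact mprod_corner_ract flip: corner_fadjoint lim.lact_ract)
    also have "\<dots> \<in> pos N"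
      by (rule pos_conj[OF N(1,1) corner_pos[OF N(1) that] corner_carrier])
    finally show ?thesis
      using limT_in_lim_pos[OF N(1)] limT_corner[OF supported_ract[OF l N(2)]] lim.lact_ract by metis
  qed
qed

sublocale lim: ordered_F_bimodule "lim_lact scale" "lim_ract scale" "fstar star" "lim_pos pos"
  by (rule ordered_F_bimodule_lim)

abbreviation lmd where "lmd \<equiv> lim_md scale md"

section \<open>The axioms for the modulus on the limit\<close>

lemma lim_md_pos: "lmd v \<in> lim_pos pos"
  unfolding lim_md_eq[OF lim_order_props]
  by (rule limT_in_lim_pos[OF lim_order_props(1) md_pos[OF lim_order_props(1,1) corner_carrier]])

lemma lim_md_of_pos:
  assumes "v \<in> lim_pos pos"
  shows "lmd v = v"
  unfolding lim_md_eq[OF lim_order_props]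
  using md_of_pos[OF lim_order_props(1) corner_pos[OF lim_order_props(1) assms]]
    limT_corner[OF lim_order_props(2)] by simp

text \<open>The four summands occupy the four blocks of a matrix of size \<open>n + n\<close>, which
  is the positive one of \<open>md_block_sa_pos\<close> for the corner of \<open>v\<close>.\<close>

lemma lim_md_sa:
  assumes n: "1 \<le> n" and v: "supported {..<n} v"
  shows "lim.pair_plus n (lmd (fstar star v)) (lmd v) + lim.sa n v \<in> lim_pos pos"
proof -
  let ?V = "corner n v"
  let ?P = "md n n (mstar star ?V)" and ?Q = "md n n ?V"
  have V': "corner n (fstar star v) = mstar star ?V"
    by (rule eq_matI) (auto simp: entry_fstar star_zero)
  have c: "mstar star ?V \<in> carrier_mat n n" by auto
  note PQ = md_carrier[OF n n c] md_carrier[OF n n corner_carrier, of v]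
  let ?M = "diag_block_mat [?P, ?Q] +
    mat (n + n) (n + n) (\<lambda>(i, j). if i < n \<and> n \<le> j then ?V $$ (i, j - n)
      else if n \<le> i \<and> j < n then star (?V $$ (j, i - n)) else 0)"
  have "lim.pair_plus n (lmd (fstar star v)) (lmd v) + lim.sa n v = limT (n + n) ?M"
    unfolding lim.pair_plus_def lim.sa_def
    using PQ by (intro fmat_eqI)
      (auto simp: plus_fmat.rep_eq entry_fJ_conj entry_fI_fJ entry_fJ_fI entry_fstar star_zero
        lim_md_eq[OF n v] lim_md_eq[OF n supported_fstar[OF v]] V' limT.rep_eq
        diag_block_mat_index[OF PQ] simp del: diag_block_mat.simps)
  moreover have "?M \<in> pos (n + n)" by (rule md_block_sa_pos[OF n corner_carrier])
  ultimately show ?thesis using limT_in_lim_pos[of "n + n"] n by simp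
qed

text \<open>At a common size this is the multiplication axiom for matrices, with the operator norm
  of \<open>a\<close> on the sequence space as an upper bound for the norm of its corner.\<close>

lemma lim_md_mult:
  "lim.scal (of_real (fnorm a)) (lmd (lmd v \<triangleleft> b)) - lmd (a \<triangleright> v \<triangleleft> b) \<in> lim_pos pos"
proof -
  obtain N where N: "1 \<le> N" "supported {..<N} a" "supported {..<N} b" "supported {..<N} v"
    using ex_supported3 by metis
  note S = supported_lact[OF N(2,4)] supported_ract[OF supported_lact[OF N(2,4)] N(3)]
    supported_lim_md[OF N(1,4)] supported_ract[OF supported_lim_md[OF N(1,4)] N(3)]
  note SS = supported_lim_md[OF N(1) S(4)] supported_lim_md[OF N(1) S(2)]
  let ?k = "fnorm a" and ?A = "corner N a" and ?B = "corner N b" and ?V = "corner N v"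
  let ?x = "lim.scal (of_real ?k) (lmd (lmd v \<triangleleft> b))"
  have "corner N ?x = map_mat (scale (of_real ?k)) (corner N (lmd (lmd v \<triangleleft> b)))"
    by (rule eq_matI) (auto simp: entry_scal)
  also have "corner N (lmd (lmd v \<triangleleft> b)) = md N N (rmult (md N N ?V) ?B)"
    unfolding corner_lim_md[OF N(1) S(4)] corner_lim_md[OF N(1,4), symmetric]
    using N(3) by (simp add: mprod_corner_ract)
  finally have x: "corner N ?x = map_mat (scale (of_real ?k)) (md N N (rmult (md N N ?V) ?B))" .
  have y: "corner N (lmd ((a \<triangleright> v) \<triangleleft> b)) = md N N (rmult (lmult ?A ?V) ?B)"
    unfolding corner_lim_md[OF N(1) S(2)]
    using N by (simp add: mprod_corner_ract mprod_corner_lact)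
  have sx: "supported {..<N} ?x"
    using SS(1) by (auto simp: supported_def entry_scal)
  have "corner N (?x - lmd ((a \<triangleright> v) \<triangleleft> b)) \<in> pos N"
    unfolding corner_diff x y
    by (rule md_mult_le[OF N(1) corner_carrier corner_carrier corner_carrier mnorm_corner_le_fnorm[OF N(2)]])
  then show ?thesis
    using lim_pos_iff[OF N(1) supported_diff[OF sx SS(2)]] by (simp add: lim.lact_ract)
qed

text \<open>The orthogonality relation in the last axioms means the same in the limit as among
  matrices of a common size.\<close>

lemma lim_md_orth_iff:
  assumes N: "1 \<le> N" and uv: "supported {..<N} u" "supported {..<N} v"
  shows "lmd (u - v) = u + v \<longleftrightarrow> md N N (corner N u - corner N v) = corner N u + corner N v"
  using fmat_eq_iff_corner[OF supported_lim_md[OF N supported_diff[OF uv]] supported_add[OF uv]]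
  by (simp add: corner_lim_md[OF N supported_diff[OF uv]] corner_diff corner_add)

lemma nondegenerate_absolutely_ordered_F_bimodule_lim:
  "nondegenerate_absolutely_ordered_F_bimodule
     (lim_lact scale) (lim_ract scale) (fstar star) (lim_pos pos) lmd"
proof
  fix a b :: "complex fmat" and u v w :: "'v fmat"
  \<comment> \<open>The axioms that mention the order are taken at the order of \<open>v\<close>;
    the orthogonality axioms use one size \<open>N\<close> for all three elements.\<close>
  note n = lim_order_props[of v]
  obtain N where N: "1 \<le> N" and s: "supported {..<N} u" "supported {..<N} v" "supported {..<N} w"
    using ex_supported3 by metis
  show "\<exists>n\<ge>1. fI n \<triangleright> v \<triangleleft> fI n = v"
    using n fI_compress_iff lim.lact_ract by metis
  show "lmd v \<in> lim_pos pos" by (rule lim_md_pos)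
  show "bimod_order (lim_lact scale) (lim_ract scale) (lmd v) \<le> bimod_order (lim_lact scale) (lim_ract scale) v"
    using lim_order_le[OF n(1) supported_lim_md[OF n]] by (simp add: lim_order_def)
  show "v \<in> lim_pos pos \<Longrightarrow> lmd v = v" by (rule lim_md_of_pos)
  show "lim.pair_plus (lim.ord v) (lmd (fstar star v)) (lmd v) + lim.sa (lim.ord v) v \<in> lim_pos pos"
    using lim_md_sa[OF n] by (simp add: lim_order_def)
  show "lim.scal (complex_of_real (fnorm a)) (lmd (lmd v \<triangleleft> b)) - lmd (a \<triangleright> v \<triangleleft> b) \<in> lim_pos pos"
    by (rule lim_md_mult)
  show "lmd (u + v) = lmd u + lmd v" if "lim.F_independent u v"
    using that lim_md_add unfolding lim.F_independent_def by (metis fdiag_compress_iff lim.lact_ract)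
  assume p: "u \<in> lim_pos pos" "v \<in> lim_pos pos" "w \<in> lim_pos pos" and uv: "lmd (u - v) = u + v"
  note cp = corner_pos[OF N p(1)] corner_pos[OF N p(2)] corner_pos[OF N p(3)]
  note uv' = iffD1[OF lim_md_orth_iff[OF N s(1,2)] uv]
  show "lmd (u - w) = u + w" if "v - w \<in> lim_pos pos"
    unfolding lim_md_orth_iff[OF N s(1,3)]
    using md_orth_le[OF N cp uv'] corner_pos[OF N that] by (simp add: corner_diff)
  assume uw: "lmd (u - w) = u + w"
  note uw' = iffD1[OF lim_md_orth_iff[OF N s(1,3)] uw]
  have sum: "supported {..<N} (v + w)" and diff: "supported {..<N} (v - w)"
    using supported_add supported_diff s by auto
  show "lmd (u - lmd (v + w)) = u + lmd (v + w)"
    unfolding lim_md_orth_iff[OF N s(1) supported_lim_md[OF N sum]] corner_lim_md[OF N sum] corner_add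
    by (rule md_orth_md_add[OF N cp uv' uw'])
  show "lmd (u - lmd (v - w)) = u + lmd (v - w)"
    unfolding lim_md_orth_iff[OF N s(1) supported_lim_md[OF N diff]] corner_lim_md[OF N diff] corner_diff
    by (rule md_orth_md_diff[OF N cp uv' uw'])
qed

end

theorem theorem3p12:
  fixes scale :: "complex \<Rightarrow> 'v::ab_group_add \<Rightarrow> 'v"
    and star :: "'v \<Rightarrow> 'v"
    and pos :: "nat \<Rightarrow> 'v mat set"
    and md :: "nat \<Rightarrow> nat \<Rightarrow> 'v mat \<Rightarrow> 'v mat"
  assumes "absolutely_matrix_ordered_space scale star pos md"
  shows "nondegenerate_absolutely_ordered_F_bimodule
           (lim_lact scale) (lim_ract scale) (fstar star) (lim_pos pos) (lim_md scale md)"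
  using assms by (rule absolutely_matrix_ordered_space.nondegenerate_absolutely_ordered_F_bimodule_lim)

end
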